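(* Let $X,Y$ be compact metrizable spaces, let $r,N\in\mathbb{N}$, and let $\mathcal{F}=(g_1,\ldots,g_N)$ be an $N$-tuple of continuous injective functions from $X$ to $Y$. For every $f:Y\to[0,1]^r$, let $f^{\mathcal{F}}:X\to([0,1]^r)^N$ be given by $f^{\mathcal{F}}(x)_i=f(g_i(x))$ for $i\in\{1,\ldots,N\}$. For every partition $\mathcal{P}$ of $\mathcal{F}$ let $$X_{\mathcal{P}}:=\{x\in X:\ \forall g_{i_1},g_{i_2}\in\mathcal{F},\ g_{i_1}(x)=g_{i_2}(x)\Leftrightarrow \mathcal{P}(g_{i_1})=\mathcal{P}(g_{i_2})\}.$$ Suppose that for every partition $\mathcal{P}$ of $\mathcal{F}$ it holds that $$\dim X_{\mathcal{P}}<\frac{r}{2}|\mathcal{P}|.$$ Then the set of functions $f\in C(Y,[0,1]^r)$ for which $f^{\mathcal{F}}:X\to([0,1]^r)^N$ is injective is a dense $G_\delta$ subset of $C(Y,[0,1]^r)$.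
   Context: $\mathbb{N}=\{1,2,\dots\}$. A partition of the tuple $\mathcal{F}=(g_1,\ldots,g_N)$ is understood as a partition of its index set $\{1,\ldots,N\}$; $\mathcal{P}(g_i)$ denotes the unique element of $\mathcal{P}$ containing (the index of) $g_i$, and $|\mathcal{P}|$ is the number of elements of $\mathcal{P}$. $\dim$ denotes Lebesgue covering dimension (the empty set has dimension at most $0$). $C(Y,[0,1]^r)$ is the space of continuous functions $Y\to[0,1]^r$ with the topology of uniform convergence. *)

theory Defs
  imports "HOL-Analysis.Analysis" "HOL-Library.Disjoint_Sets"
begin

(* Lebesgue covering dimension, in the standard formulation with finite open covers.
   An order of at most n means that every point lies in at most n + 1 members of the cover. *)
definition covering_dim_le :: "'a topology \<Rightarrow> nat \<Rightarrow> bool" where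
  "covering_dim_le T n \<longleftrightarrow>
    (\<forall>\<U>. finite \<U> \<and> (\<forall>U\<in>\<U>. openin T U) \<and> \<Union>\<U> = topspace T \<longrightarrow>
      (\<exists>\<V>. finite \<V> \<and> (\<forall>V\<in>\<V>. openin T V) \<and> \<Union>\<V> = topspace T \<and>
           (\<forall>V\<in>\<V>. \<exists>U\<in>\<U>. V \<subseteq> U) \<and>
           (\<forall>x\<in>topspace T. card {V \<in> \<V>. x \<in> V} \<le> n + 1)))"

(* The value is \<infinity> (the infimum of the empty set in enat) if no bound exists;
   the empty space gets dimension 0. *)
definition covering_dim :: "'a topology \<Rightarrow> enat" where
  "covering_dim T = Inf {enat n |n. covering_dim_le T n}"

definition unit_cube :: "(real ^ 'r) set" where
  "unit_cube = {v. \<forall>k. 0 \<le> v $ k \<and> v $ k \<le> 1}"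

(* C(Y, [0,1]^r) with the supremum metric; its points are functions that are
   extensional outside topspace Y, so that equality is equality on Y. *)
definition cube_maps :: "'b topology \<Rightarrow> ('b \<Rightarrow> real ^ 'r) metric" where
  "cube_maps Y = cfunspace Y (submetric euclidean_metric unit_cube)"

(* The map f^F from X to ([0,1]^r)^N, where F = (g 1, ..., g N). *)
definition tuple_map :: "nat \<Rightarrow> (nat \<Rightarrow> 'a \<Rightarrow> 'b) \<Rightarrow> ('b \<Rightarrow> 'c) \<Rightarrow> 'a \<Rightarrow> (nat \<Rightarrow> 'c)" where
  "tuple_map N g f x = (\<lambda>i\<in>{1..N}. f (g i x))"

definition block :: "'i set set \<Rightarrow> 'i \<Rightarrow> 'i set" where
  "block P i = (THE B. B \<in> P \<and> i \<in> B)"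

(* The set X_P of points whose coincidence pattern under g 1, ..., g N is exactly P. *)
definition coincidence_set ::
    "'a topology \<Rightarrow> nat \<Rightarrow> (nat \<Rightarrow> 'a \<Rightarrow> 'b) \<Rightarrow> nat set set \<Rightarrow> 'a set" where
  "coincidence_set X N g P =
    {x \<in> topspace X. \<forall>i\<in>{1..N}. \<forall>j\<in>{1..N}. g i x = g j x \<longleftrightarrow> block P i = block P j}"

end

theory Submission
  imports Defs
begin

text \<open>
  By Baire's theorem it suffices to treat countably many compact sets of pairs \<open>(x, y)\<close> off the diagonal,
  each with a fixed pattern of coincidences among the points \<open>g i x\<close> and \<open>g i y\<close>. Join \<open>g i x\<close> to
  \<open>g i y\<close>: this is a graph without loops or isolated vertices, so among the equations
  \<open>f (g i x) = f (g i y)\<close> one finds at least half as many independent ones, each in \<open>r\<close> coordinates, as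
  there are vertices. The hypothesis makes this number exceed the dimension of the set of pairs: if
  no \<open>g i x\<close> meets a \<open>g j y\<close>, the dimensions of the sets of \<open>x\<close> and of \<open>y\<close> add up and so do the
  numbers of vertices, and otherwise \<open>x\<close> determines \<open>y\<close>. As in the Menger-Noebeling theorem,
  one replaces \<open>f\<close> near the points by a combination of a partition of unity of small order with
  generic coefficients, which makes the overdetermined system unsolvable, and extends by Tietze.
\<close>

text \<open>The factor one half is natural: without coincidences the graph consists of
  \<open>N\<close> disjoint edges on \<open>2 * N\<close> vertices. With coincidences the obstacle
  is that equations share vertices, so a coefficient chosen for one equation enters others.
  Perturbing only at a set \<open>Z\<close> of vertices, each compared with a vertex outside
  \<open>Z\<close> whose coefficients were fixed beforehand, decouples the choices. A second
  obstacle is that coincidence sets mix equalities with inequalities and need not be closed. On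
  small closed boxes whose non-coinciding images stay disjoint, the equalities alone cut out a
  compact set. Its projections are closed inside a coincidence set, so the dimension bound passes to
  them, and distinct vertices sweep out disjoint closed subsets of \<open>Y\<close>, on which values
  can be prescribed freely. Dimensions are added without any product of spaces: \<open>x\<close> and
  \<open>y\<close> keep separate partitions of unity, and it is the numbers of free weights that add
  up.\<close>

section \<open>Overdetermined linear systems with generic coefficients\<close>

text \<open>A coordinate on which the new hyperplane depends can be moved off finitely many values,
  which keeps all the earlier hyperplanes avoided as well.\<close>

lemma avoid_hyperplanes_in_box:
  fixes l u :: "'i \<Rightarrow> real"
  assumes "finite I" "finite H"
    and "\<And>i. i \<in> I \<Longrightarrow> l i < u i"
    and "\<And>w c. (w, c) \<in> H \<Longrightarrow> \<exists>i\<in>I. w i \<noteq> 0"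
  shows "\<exists>a. (\<forall>i\<in>I. l i < a i \<and> a i < u i) \<and> (\<forall>(w, c)\<in>H. (\<Sum>i\<in>I. w i * a i) \<noteq> c)"
  using assms(2,4)
proof (induction H rule: finite_induct)
  case empty
  show ?case
    by (rule exI[of _ "\<lambda>i. (l i + u i) / 2"]) (use assms(3) in force)
next
  case (insert h H)
  then obtain a where a: "\<forall>i\<in>I. l i < a i \<and> a i < u i"
    and aH: "\<forall>(w, c)\<in>H. (\<Sum>i\<in>I. w i * a i) \<noteq> c"
    by fast
  obtain w0 c0 where h: "h = (w0, c0)" by force
  obtain m where m: "m \<in> I" "w0 m \<noteq> 0" using insert.prems h by blast
  \<comment> \<open>For each hyperplane, the one value of coordinate \<open>m\<close> that would put
    the point on it. If \<open>w m = 0\<close>, moving this coordinate changes nothing and the point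
    stays off the hyperplane; the default 0 then excludes one more value, which is harmless.\<close>
  define bad where "bad = (\<lambda>(w, c). if w m = 0 then 0 else (c - (\<Sum>i\<in>I - {m}. w i * a i)) / w m) ` insert h H"
  have "finite bad" using insert.hyps by (simp add: bad_def)
  then have "infinite ({l m<..<u m} - bad)"
    using assms(3)[OF m(1)] by (simp add: infinite_Ioo)
  then have "{l m<..<u m} - bad \<noteq> {}" by (metis finite.emptyI)
  then obtain s where s: "l m < s" "s < u m" "s \<notin> bad" by force
  define a' where "a' = a(m := s)"
  have split: "(\<Sum>i\<in>I. w i * a' i) = w m * s + (\<Sum>i\<in>I - {m}. w i * a i)" for w
    using assms(1) m(1) by (simp add: sum.remove[of I m] a'_def)
  have split_a: "(\<Sum>i\<in>I. w i * a i) = w m * a m + (\<Sum>i\<in>I - {m}. w i * a i)" for w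
    using assms(1) m(1) by (simp add: sum.remove[of I m])
  have "(\<Sum>i\<in>I. w i * a' i) \<noteq> c" if wc: "(w, c) \<in> insert h H" for w c
  proof (cases "w m = 0")
    case True
    then have "(w, c) \<in> H" using wc h m by auto
    then have "(\<Sum>i\<in>I. w i * a i) \<noteq> c" using aH by blast
    then show ?thesis using True by (simp add: split split_a)
  next
    case False
    then have "(c - (\<Sum>i\<in>I - {m}. w i * a i)) / w m \<in> bad"
      using wc unfolding bad_def by force
    then have "s \<noteq> (c - (\<Sum>i\<in>I - {m}. w i * a i)) / w m" using s by blast
    then show ?thesis using False unfolding split by (auto simp: field_simps)
  qed
  moreover have "\<forall>i\<in>I. l i < a' i \<and> a' i < u i" using a s by (simp add: a'_def)
  ultimately show ?case by blast
qed

text \<open>An upper bound on the affine dimension, phrased through parametrisations because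
  functions on an arbitrary index type do not form a Euclidean space.\<close>
definition flat :: "nat \<Rightarrow> ('x \<Rightarrow> real) set \<Rightarrow> bool" where
  "flat n S \<longleftrightarrow> (\<exists>x0 u (J :: 'x set). finite J \<and> card J \<le> n \<and>
     S = {\<lambda>x. x0 x + (\<Sum>j\<in>J. c j * u j x) |c. True})"

text \<open>The witness \<open>\<phi>0\<close> shows that the linear functional does not vanish
  identically on \<open>S\<close>. Either it is a nonzero constant there, or some direction changes
  it and the parameter of that direction can be eliminated.\<close>

lemma flat_Int_hyperplane:
  fixes S :: "('x \<Rightarrow> real) set" and w :: "'x \<Rightarrow> real"
  assumes "flat n S" "finite D"
    and "\<phi>0 \<in> S" "(\<Sum>x\<in>D. w x * \<phi>0 x) \<noteq> 0"
  shows "{\<phi>\<in>S. (\<Sum>x\<in>D. w x * \<phi> x) = 0} = {} \<or>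
    (n > 0 \<and> flat (n - 1) {\<phi>\<in>S. (\<Sum>x\<in>D. w x * \<phi> x) = 0})"
proof -
  define L where "L = (\<lambda>\<phi>::'x\<Rightarrow>real. \<Sum>x\<in>D. w x * \<phi> x)"
  obtain x0 u and J :: "'x set" where J: "finite J" "card J \<le> n"
    and S: "S = {\<lambda>x. x0 x + (\<Sum>j\<in>J. c j * u j x) |c. True}"
    using assms(1) unfolding flat_def by auto
  define e where "e j = L (u j)" for j
  have L: "L (\<lambda>x. x0 x + (\<Sum>j\<in>J. c j * u j x)) = L x0 + (\<Sum>j\<in>J. c j * e j)" for c
  proof -
    have "L (\<lambda>x. x0 x + (\<Sum>j\<in>J. c j * u j x)) = L x0 + (\<Sum>x\<in>D. \<Sum>j\<in>J. w x * (c j * u j x))"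
      by (simp add: L_def sum.distrib sum_distrib_left distrib_left)
    also have "(\<Sum>x\<in>D. \<Sum>j\<in>J. w x * (c j * u j x)) = (\<Sum>j\<in>J. \<Sum>x\<in>D. w x * (c j * u j x))"
      by (rule sum.swap)
    also have "\<dots> = (\<Sum>j\<in>J. c j * e j)"
      by (simp add: e_def L_def sum_distrib_left mult.left_commute)
    finally show ?thesis .
  qed
  show ?thesis
  proof (cases "\<forall>j\<in>J. e j = 0")
    case True
    then have const: "L \<phi> = L x0" if "\<phi> \<in> S" for \<phi> using that L S by auto
    then have "L x0 \<noteq> 0" using assms(3,4) by (metis L_def)
    then have "{\<phi>\<in>S. L \<phi> = 0} = {}" using const by auto
    then show ?thesis by (simp add: L_def)
  next
    case False
    then obtain m where m: "m \<in> J" "e m \<noteq> 0" by blast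
    \<comment> \<open>\<open>y0\<close> and \<open>v\<close> are the base point and the remaining
      directions, sheared along \<open>u m\<close> into the zero set and into the kernel of the
      functional.\<close>
    define y0 where "y0 = (\<lambda>x. x0 x - L x0 / e m * u m x)"
    define v where "v = (\<lambda>j x. u j x - e j / e m * u m x)"
    have expand: "y0 x + (\<Sum>j\<in>J-{m}. c j * v j x) =
        x0 x + (\<Sum>j\<in>J-{m}. c j * u j x) + (- (L x0 + (\<Sum>j\<in>J-{m}. c j * e j)) / e m) * u m x" for c x
    proof -
      have "(\<Sum>j\<in>J-{m}. c j * v j x) = (\<Sum>j\<in>J-{m}. c j * u j x) - (\<Sum>j\<in>J-{m}. c j * e j) / e m * u m x"
        by (simp add: v_def right_diff_distrib sum_subtractf sum_divide_distrib sum_distrib_right mult.assoc)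
      then show ?thesis by (simp add: y0_def add_divide_distrib diff_divide_distrib left_diff_distrib distrib_right)
    qed
    have "{\<phi>\<in>S. L \<phi> = 0} = {\<lambda>x. y0 x + (\<Sum>j\<in>J-{m}. c j * v j x) |c. True}" (is "?A = ?B")
    proof (intro equalityI subsetI)
      fix \<phi> assume "\<phi> \<in> ?A"
      then obtain c where c: "\<phi> = (\<lambda>x. x0 x + (\<Sum>j\<in>J. c j * u j x))" and z: "L \<phi> = 0"
        using S by auto
      have "L x0 + (\<Sum>j\<in>J. c j * e j) = 0" using z L c by simp
      then have "c m * e m = - (L x0 + (\<Sum>j\<in>J-{m}. c j * e j))"
        using m J by (simp add: sum.remove[of J m])
      then have cm: "c m = - (L x0 + (\<Sum>j\<in>J-{m}. c j * e j)) / e m"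
        using m by (simp add: field_simps)
      have "\<phi> = (\<lambda>x. y0 x + (\<Sum>j\<in>J-{m}. c j * v j x))"
        unfolding expand cm[symmetric] c using m J by (simp add: sum.remove[of J m] fun_eq_iff)
      then show "\<phi> \<in> ?B" by blast
    next
      fix \<phi> assume "\<phi> \<in> ?B"
      then obtain c where c: "\<phi> = (\<lambda>x. y0 x + (\<Sum>j\<in>J-{m}. c j * v j x))" by blast
      define c' where "c' = c(m := - (L x0 + (\<Sum>j\<in>J-{m}. c j * e j)) / e m)"
      have c': "\<phi> = (\<lambda>x. x0 x + (\<Sum>j\<in>J. c' j * u j x))"
        unfolding c expand using m J by (simp add: sum.remove[of J m] fun_eq_iff c'_def)
      have "L \<phi> = L x0 + (\<Sum>j\<in>J. c' j * e j)" unfolding c' by (rule L)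
      also have "\<dots> = 0" using m J by (simp add: sum.remove[of J m] c'_def)
      finally show "\<phi> \<in> ?A" using c' S by blast
    qed
    then have "flat (n - 1) {\<phi>\<in>S. L \<phi> = 0}"
      unfolding flat_def using m J by (intro exI[of _ y0] exI[of _ v] exI[of _ "J - {m}"]) simp
    moreover have "n > 0" using m J by (metis card_gt_0_iff empty_iff order_less_le_trans)
    ultimately show ?thesis by (simp add: L_def)
  qed
qed

text \<open>For each \<open>t\<close> this is the affine hull of a simplex whose vertices are those
  that \<open>A\<close> lists at \<open>t\<close>: at most \<open>d t + 1\<close> vertices leave at
  most \<open>d t\<close> free barycentric coordinates. No signs are imposed, so that adding
  equations remains linear algebra.\<close>

lemma flat_simplices:
  assumes "finite T" "A \<subseteq> Sigma T I" "\<And>t. t \<in> T \<Longrightarrow> finite (I t)"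
    and "\<And>t. t \<in> T \<Longrightarrow> A `` {t} \<noteq> {}"
    and "\<And>t. t \<in> T \<Longrightarrow> card (A `` {t}) \<le> d t + 1"
  shows "flat (\<Sum>t\<in>T. d t)
    {\<phi>. (\<forall>t\<in>T. (\<Sum>i\<in>I t. \<phi> (t, i)) = (1::real)) \<and> (\<forall>x. x \<notin> A \<longrightarrow> \<phi> x = 0)}" (is "flat _ ?S")
proof -
  have "\<forall>t\<in>T. \<exists>b. b \<in> A `` {t}" using assms(4) by blast
  then obtain b where b: "\<And>t. t \<in> T \<Longrightarrow> (t, b t) \<in> A" by (metis ImageE singletonD)
  \<comment> \<open>One base vertex per \<open>t\<close>. Its coordinate is determined by the
    others, which \<open>J\<close> collects as parameters; the direction \<open>u j\<close> below
    moves weight from the base vertex to \<open>j\<close>.\<close>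
  define B where "B = (\<lambda>t. (t, b t)) ` T"
  define J where "J = A - B"
  have finA: "finite A" using assms(1-3) by (meson finite_SigmaI finite_subset)
  then have finJ: "finite J" by (simp add: J_def)
  have A_eq: "A = Sigma T (\<lambda>t. A `` {t})" using assms(2) by auto
  have finAt: "finite (A `` {t})" if "t \<in> T" for t
    using finA by (rule finite_Image)
  have J_eq: "J = Sigma T (\<lambda>t. A `` {t} - {b t})"
    using A_eq by (auto simp: J_def B_def)
  have "card J = (\<Sum>t\<in>T. card (A `` {t} - {b t}))"
    unfolding J_eq using assms(1) finAt by (simp add: card_SigmaI)
  also have "\<dots> \<le> (\<Sum>t\<in>T. d t)"
  proof (rule sum_mono)
    fix t assume t: "t \<in> T"
    show "card (A `` {t} - {b t}) \<le> d t"
      using assms(5)[OF t] b[OF t] finAt[OF t] by (simp add: card_Diff_singleton)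
  qed
  finally have cardJ: "card J \<le> (\<Sum>t\<in>T. d t)" .
  define x0 where "x0 = (\<lambda>x. if x \<in> B then 1 else (0::real))"
  define u where "u = (\<lambda>j x. (if x = j then 1 else 0) - (if x = (fst j, b (fst j)) then 1 else (0::real)))"
  have row: "x0 (t, i) + (\<Sum>j\<in>J. c j * u j (t, i)) =
     (if (t, i) \<in> J then c (t, i) else if (t, i) \<in> B then 1 - (\<Sum>k\<in>A `` {t} - {b t}. c (t, k)) else 0)"
    for c t i
  proof -
    have s1: "(\<Sum>j\<in>J. c j * u j (t, i)) = (\<Sum>j\<in>J. if j = (t, i) then c j else 0)
       - (\<Sum>j\<in>J. if (t, i) = (fst j, b (fst j)) then c j else 0)"
      unfolding sum_subtractf[symmetric] by (rule sum.cong) (auto simp: u_def)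
    have s2: "(\<Sum>j\<in>J. if j = (t, i) then c j else 0) = (if (t, i) \<in> J then c (t, i) else 0)"
      using finJ by (simp add: sum.delta)
    have s3: "(\<Sum>j\<in>J. if (t, i) = (fst j, b (fst j)) then c j else 0) =
       (if (t, i) \<in> B then (\<Sum>k\<in>A `` {t} - {b t}. c (t, k)) else 0)"
    proof (cases "(t, i) \<in> B")
      case True
      then have ti: "t \<in> T" "i = b t" by (auto simp: B_def)
      have "(\<Sum>j\<in>J. if (t, i) = (fst j, b (fst j)) then c j else 0) = (\<Sum>j | j \<in> J \<and> fst j = t. c j)"
        using ti unfolding sum.inter_filter[OF finJ] by (intro sum.cong) auto
      also have "{j. j \<in> J \<and> fst j = t} = Pair t ` (A `` {t} - {b t})"
        using ti by (auto simp: J_eq)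
      also have "(\<Sum>j\<in>Pair t ` (A `` {t} - {b t}). c j) = (\<Sum>k\<in>A `` {t} - {b t}. c (t, k))"
        by (subst sum.reindex) (auto simp: inj_on_def)
      finally show ?thesis using True by simp
    next
      case False
      have "(t, i) \<noteq> (fst j, b (fst j))" if "j \<in> J" for j
        using that False by (auto simp: J_eq B_def)
      then have "(\<Sum>j\<in>J. if (t, i) = (fst j, b (fst j)) then c j else 0) = 0"
        by (intro sum.neutral ballI) (simp only: if_False)
      then show ?thesis using False by simp
    qed
    show ?thesis unfolding s1 s2 s3 by (auto simp: x0_def J_def)
  qed
  have "?S = {\<lambda>x. x0 x + (\<Sum>j\<in>J. c j * u j x) |c. True}" (is "_ = ?R")
  proof (intro equalityI subsetI)
    fix \<phi> assume \<phi>: "\<phi> \<in> ?S"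
    have sumA: "(\<Sum>k\<in>A `` {t}. \<phi> (t, k)) = 1" if t: "t \<in> T" for t
    proof -
      have "(\<Sum>k\<in>A `` {t}. \<phi> (t, k)) = (\<Sum>k\<in>I t. \<phi> (t, k))"
        using assms(2,3) t \<phi> by (intro sum.mono_neutral_left) auto
      then show ?thesis using \<phi> t by simp
    qed
    have "\<phi> x = x0 x + (\<Sum>j\<in>J. \<phi> j * u j x)" for x
    proof -
      obtain t i where x: "x = (t, i)" by force
      show ?thesis
      proof (cases "(t, i) \<in> B")
        case True
        then have t: "t \<in> T" "i = b t" by (auto simp: B_def)
        have "b t \<in> A `` {t}" using b t by blast
        then have "\<phi> (t, b t) = 1 - (\<Sum>k\<in>A `` {t} - {b t}. \<phi> (t, k))"
          using sumA[OF t(1)] finAt[OF t(1)] by (simp add: sum.remove[of "A `` {t}" "b t"])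
        moreover have "(t, i) \<notin> J" using True by (simp add: J_def)
        ultimately show ?thesis unfolding x row using True t by simp
      next
        case False
        then show ?thesis unfolding x row using \<phi> by (auto simp: J_def)
      qed
    qed
    then show "\<phi> \<in> ?R" by blast
  next
    fix \<phi> assume "\<phi> \<in> ?R"
    then obtain c where c: "\<phi> = (\<lambda>x. x0 x + (\<Sum>j\<in>J. c j * u j x))" by blast
    have val: "\<phi> (t, i) = (if (t, i) \<in> J then c (t, i) else if (t, i) \<in> B then 1 - (\<Sum>k\<in>A `` {t} - {b t}. c (t, k)) else 0)" for t i
      unfolding c by (rule row)
    have BA: "B \<subseteq> A" using b by (auto simp: B_def)
    have zero: "\<phi> x = 0" if "x \<notin> A" for x
      using that BA val[of "fst x" "snd x"] by (auto simp: J_def)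
    have "(\<Sum>k\<in>I t. \<phi> (t, k)) = 1" if t: "t \<in> T" for t
    proof -
      have bt: "b t \<in> A `` {t}" using b t by blast
      have "(\<Sum>k\<in>I t. \<phi> (t, k)) = (\<Sum>k\<in>A `` {t}. \<phi> (t, k))"
        using assms(2,3) t zero by (intro sum.mono_neutral_right) auto
      also have "\<dots> = \<phi> (t, b t) + (\<Sum>k\<in>A `` {t} - {b t}. \<phi> (t, k))"
        using finAt[OF t] bt by (simp add: sum.remove[of "A `` {t}" "b t"])
      also have "(\<Sum>k\<in>A `` {t} - {b t}. \<phi> (t, k)) = (\<Sum>k\<in>A `` {t} - {b t}. c (t, k))"
        by (rule sum.cong) (use t in \<open>auto simp: val J_eq\<close>)
      also have "\<phi> (t, b t) = 1 - (\<Sum>k\<in>A `` {t} - {b t}. c (t, k))"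
        using t by (simp add: val J_def B_def)
      finally show ?thesis by simp
    qed
    then show "\<phi> \<in> ?S" using zero by blast
  qed
  then show ?thesis unfolding flat_def using finJ cardJ
    by (intro exI[of _ x0] exI[of _ u] exI[of _ J]) simp
qed

text \<open>The equations are imposed one at a time. Each new one is chosen so that, for every admissible
  support, it fails at some solution of the previous ones; this cuts the dimension of the solution
  set, which is initially at most the sum of the \<open>d t\<close>, by one.\<close>
lemma generic_coefficients:
  fixes T :: "'t set" and I :: "'t \<Rightarrow> 'i set" and Q :: "'q set"
    and \<sigma> \<rho> :: "'q \<Rightarrow> 't" and \<beta> l u :: "'q \<Rightarrow> 'i \<Rightarrow> real" and d :: "'t \<Rightarrow> nat"
  assumes finT: "finite T" and finI: "\<And>t. t \<in> T \<Longrightarrow> finite (I t)" and finQ: "finite Q"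
    and \<sigma>: "\<And>q. q \<in> Q \<Longrightarrow> \<sigma> q \<in> T" and \<rho>: "\<And>q. q \<in> Q \<Longrightarrow> \<rho> q \<in> T"
    and less: "(\<Sum>t\<in>T. d t) < card Q"
    and lu: "\<And>q i. q \<in> Q \<Longrightarrow> i \<in> I (\<sigma> q) \<Longrightarrow> l q i < u q i"
  obtains \<alpha> where "\<And>q i. q \<in> Q \<Longrightarrow> i \<in> I (\<sigma> q) \<Longrightarrow> l q i < \<alpha> q i \<and> \<alpha> q i < u q i"
    and "\<forall>\<phi>. (\<forall>t\<in>T. (\<Sum>i\<in>I t. \<phi> t i) = 1 \<and> card {i \<in> I t. \<phi> t i \<noteq> 0} \<le> d t + 1) \<longrightarrow>
      (\<exists>q\<in>Q. (\<Sum>i\<in>I (\<sigma> q). \<phi> (\<sigma> q) i * \<alpha> q i) \<noteq> (\<Sum>i\<in>I (\<rho> q). \<phi> (\<rho> q) i * \<beta> q i))"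
proof -
  \<comment> \<open>The possible supports. Solutions are sorted by support because a fixed support
    gives a flat of dimension at most the sum of the \<open>d t\<close>; as there are finitely many
    supports, one choice of coefficients can serve them all.\<close>
  define \<A> where "\<A> = {A. A \<subseteq> Sigma T I \<and> (\<forall>t\<in>T. A `` {t} \<noteq> {} \<and> card (A `` {t}) \<le> d t + 1)}"
  define base where "base A = {\<phi>. (\<forall>t\<in>T. (\<Sum>i\<in>I t. \<phi> (t, i)) = (1::real)) \<and> (\<forall>x. x \<notin> A \<longrightarrow> \<phi> x = 0)}" for A
  \<comment> \<open>Equation \<open>q\<close> as a linear functional of the unknown weights. The two
    contributions are subtracted rather than split into cases, since \<open>\<sigma> q\<close> and
    \<open>\<rho> q\<close> may be equal.\<close>
  define w where "w q a x = (if fst x = \<sigma> q then a (snd x) else 0) - (if fst x = \<rho> q then \<beta> q (snd x) else 0)" for q a x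
  define E where "E q a \<phi> = (\<Sum>x\<in>Sigma T I. w q a x * \<phi> x)" for q a and \<phi> :: "'t \<times> 'i \<Rightarrow> real"
  define sol where "sol A Q' \<alpha> = {\<phi>\<in>base A. \<forall>q\<in>Q'. E q (\<alpha> q) \<phi> = 0}" for A Q' and \<alpha> :: "'q \<Rightarrow> 'i \<Rightarrow> real"
  have finS: "finite (Sigma T I)" using finT finI by blast
  have E: "E q a \<phi> = (\<Sum>i\<in>I (\<sigma> q). \<phi> (\<sigma> q, i) * a i) - (\<Sum>i\<in>I (\<rho> q). \<phi> (\<rho> q, i) * \<beta> q i)"
    if q: "q \<in> Q" for q a \<phi>
  proof -
    have "E q a \<phi> = (\<Sum>t\<in>T. \<Sum>i\<in>I t. w q a (t, i) * \<phi> (t, i))"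
      unfolding E_def using finT finI by (subst sum.Sigma) auto
    also have "\<dots> = (\<Sum>t\<in>T. (if t = \<sigma> q then \<Sum>i\<in>I t. \<phi> (t, i) * a i else 0)
        - (if t = \<rho> q then \<Sum>i\<in>I t. \<phi> (t, i) * \<beta> q i else 0))"
      by (intro sum.cong) (auto simp: w_def sum_subtractf algebra_simps sum_negf)
    also have "\<dots> = (\<Sum>i\<in>I (\<sigma> q). \<phi> (\<sigma> q, i) * a i) - (\<Sum>i\<in>I (\<rho> q). \<phi> (\<rho> q, i) * \<beta> q i)"
      using finT \<sigma>[OF q] \<rho>[OF q] by (simp add: sum_subtractf sum.delta)
    finally show ?thesis .
  qed
  have fin\<A>: "finite \<A>"
    using finS by (rule finite_subset[rotated, OF finite_Pow_iff[THEN iffD2]]) (auto simp: \<A>_def)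
  have flat0: "flat (\<Sum>t\<in>T. d t) (base A)" if "A \<in> \<A>" for A
    unfolding base_def by (rule flat_simplices) (use that finT finI in \<open>auto simp: \<A>_def\<close>)
  have "\<exists>\<alpha>. (\<forall>q\<in>Q'. \<forall>i\<in>I (\<sigma> q). l q i < \<alpha> q i \<and> \<alpha> q i < u q i) \<and>
      (\<forall>A\<in>\<A>. sol A Q' \<alpha> = {} \<or> (\<exists>n. flat n (sol A Q' \<alpha>) \<and> n + card Q' \<le> (\<Sum>t\<in>T. d t)))"
    if "Q' \<subseteq> Q" for Q'
    using finite_subset[OF that finQ] that
  proof (induction Q' rule: finite_induct)
    case empty
    have "sol A {} \<alpha> = base A" for A \<alpha> by (simp add: sol_def)
    then show ?case using flat0 by (metis add.right_neutral all_not_in_conv card.empty order_refl)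
  next
    case (insert q Q')
    then obtain \<alpha> where \<alpha>: "\<forall>q\<in>Q'. \<forall>i\<in>I (\<sigma> q). l q i < \<alpha> q i \<and> \<alpha> q i < u q i"
      and \<alpha>A: "\<forall>A\<in>\<A>. sol A Q' \<alpha> = {} \<or> (\<exists>n. flat n (sol A Q' \<alpha>) \<and> n + card Q' \<le> (\<Sum>t\<in>T. d t))"
      by blast
    have qQ: "q \<in> Q" using insert.prems by simp
    \<comment> \<open>One earlier solution per support. For fixed weights the new equation is a
      hyperplane condition on its coefficients \<open>a\<close>, nontrivial because the weights at
      \<open>\<sigma> q\<close> sum to 1. Avoiding these finitely many hyperplanes makes the
      equation fail at every \<open>p A\<close>.\<close>
    define p where "p A = (SOME \<phi>. \<phi> \<in> sol A Q' \<alpha>)" for A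
    have p: "p A \<in> sol A Q' \<alpha>" if "sol A Q' \<alpha> \<noteq> {}" for A
      unfolding p_def using that by (simp add: some_in_eq)
    define H where "H = (\<lambda>A. (\<lambda>i. p A (\<sigma> q, i), \<Sum>i\<in>I (\<rho> q). p A (\<rho> q, i) * \<beta> q i)) ` {A\<in>\<A>. sol A Q' \<alpha> \<noteq> {}}"
    have "\<exists>a. (\<forall>i\<in>I (\<sigma> q). l q i < a i \<and> a i < u q i) \<and> (\<forall>(w, c)\<in>H. (\<Sum>i\<in>I (\<sigma> q). w i * a i) \<noteq> c)"
    proof (rule avoid_hyperplanes_in_box)
      show "finite (I (\<sigma> q))" using finI \<sigma> qQ by blast
      show "finite H" using fin\<A> by (simp add: H_def)
      show "l q i < u q i" if "i \<in> I (\<sigma> q)" for i using lu qQ that by blast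
      show "\<exists>i\<in>I (\<sigma> q). w i \<noteq> 0" if wc: "(w, c) \<in> H" for w c
      proof -
        obtain A where A: "w = (\<lambda>i. p A (\<sigma> q, i))" "sol A Q' \<alpha> \<noteq> {}"
          using wc unfolding H_def by blast
        have "(\<Sum>i\<in>I (\<sigma> q). w i) = 1" using p[OF A(2)] \<sigma>[OF qQ] by (simp add: A(1) sol_def base_def)
        then show ?thesis by (metis sum.neutral zero_neq_one)
      qed
    qed
    then obtain a where a: "\<And>i. i \<in> I (\<sigma> q) \<Longrightarrow> l q i < a i \<and> a i < u q i"
      and aH: "\<And>w c. (w, c) \<in> H \<Longrightarrow> (\<Sum>i\<in>I (\<sigma> q). w i * a i) \<noteq> c" by blast
    define \<alpha>' where "\<alpha>' = \<alpha>(q := a)"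
    have solI: "sol A (insert q Q') \<alpha>' = {\<phi>\<in>sol A Q' \<alpha>. E q a \<phi> = 0}" for A
      using insert.hyps by (auto simp: sol_def \<alpha>'_def)
    have "sol A (insert q Q') \<alpha>' = {} \<or>
        (\<exists>n. flat n (sol A (insert q Q') \<alpha>') \<and> n + card (insert q Q') \<le> (\<Sum>t\<in>T. d t))" if A: "A \<in> \<A>" for A
    proof (cases "sol A Q' \<alpha> = {}")
      case True
      then show ?thesis by (simp add: solI)
    next
      case False
      then obtain n where n: "flat n (sol A Q' \<alpha>)" "n + card Q' \<le> (\<Sum>t\<in>T. d t)" using \<alpha>A A by blast
      have "E q a (p A) \<noteq> 0"
        unfolding E[OF qQ] using aH A False by (auto simp: H_def)
      then have "{\<phi>\<in>sol A Q' \<alpha>. E q a \<phi> = 0} = {} \<or> (n > 0 \<and> flat (n - 1) {\<phi>\<in>sol A Q' \<alpha>. E q a \<phi> = 0})"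
        unfolding E_def by (intro flat_Int_hyperplane[OF n(1) finS p[OF False]])
      moreover have "n - 1 + card (insert q Q') \<le> (\<Sum>t\<in>T. d t)" if "n > 0"
        using insert.hyps n that by simp
      ultimately show ?thesis unfolding solI by blast
    qed
    moreover have "\<forall>r\<in>insert q Q'. \<forall>i\<in>I (\<sigma> r). l r i < \<alpha>' r i \<and> \<alpha>' r i < u r i"
      using a \<alpha> by (simp add: \<alpha>'_def)
    ultimately show ?case by blast
  qed
  from this[of Q] obtain \<alpha> where \<alpha>: "\<forall>q\<in>Q. \<forall>i\<in>I (\<sigma> q). l q i < \<alpha> q i \<and> \<alpha> q i < u q i"
    and "\<forall>A\<in>\<A>. sol A Q \<alpha> = {} \<or> (\<exists>n. flat n (sol A Q \<alpha>) \<and> n + card Q \<le> (\<Sum>t\<in>T. d t))" by auto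
  then have none: "sol A Q \<alpha> = {}" if "A \<in> \<A>" for A using that less by fastforce
  show ?thesis
  proof (rule that)
    show "l q i < \<alpha> q i \<and> \<alpha> q i < u q i" if "q \<in> Q" "i \<in> I (\<sigma> q)" for q i using \<alpha> that by blast
    show "\<forall>\<phi>. (\<forall>t\<in>T. (\<Sum>i\<in>I t. \<phi> t i) = 1 \<and> card {i \<in> I t. \<phi> t i \<noteq> 0} \<le> d t + 1) \<longrightarrow>
      (\<exists>q\<in>Q. (\<Sum>i\<in>I (\<sigma> q). \<phi> (\<sigma> q) i * \<alpha> q i) \<noteq> (\<Sum>i\<in>I (\<rho> q). \<phi> (\<rho> q) i * \<beta> q i))"
    proof (intro allI impI)
      fix \<phi> :: "'t \<Rightarrow> 'i \<Rightarrow> real"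
      assume "\<forall>t\<in>T. (\<Sum>i\<in>I t. \<phi> t i) = 1 \<and> card {i \<in> I t. \<phi> t i \<noteq> 0} \<le> d t + 1"
      then have \<phi>: "(\<Sum>i\<in>I t. \<phi> t i) = 1 \<and> card {i \<in> I t. \<phi> t i \<noteq> 0} \<le> d t + 1" if "t \<in> T" for t
        using that by blast
      define A where "A = Sigma T (\<lambda>t. {i \<in> I t. \<phi> t i \<noteq> 0})"
      \<comment> \<open>Cut off outside the support, since members of \<open>base A\<close> vanish
        at every pair not in \<open>A\<close>, even outside \<open>Sigma T I\<close>.\<close>
      define \<psi> where "\<psi> x = (if x \<in> A then \<phi> (fst x) (snd x) else 0)" for x
      have \<psi>: "\<psi> (t, i) = \<phi> t i" if "t \<in> T" "i \<in> I t" for t i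
        using that by (auto simp: \<psi>_def A_def)
      have "A `` {t} = {i \<in> I t. \<phi> t i \<noteq> 0}" if "t \<in> T" for t
        using that by (auto simp: A_def)
      moreover have "{i \<in> I t. \<phi> t i \<noteq> 0} \<noteq> {}" if "t \<in> T" for t
        using \<phi>[OF that] by (metis (mono_tags, lifting) empty_Collect_eq sum.neutral zero_neq_one)
      moreover have "A \<subseteq> Sigma T I" by (auto simp: A_def)
      ultimately have "A \<in> \<A>" using \<phi> by (simp add: \<A>_def)
      then have "sol A Q \<alpha> = {}" by (rule none)
      moreover have "\<psi> \<in> base A" using \<phi> \<psi> by (simp add: base_def) (simp add: \<psi>_def)
      ultimately obtain q where q: "q \<in> Q" "E q (\<alpha> q) \<psi> \<noteq> 0" by (auto simp: sol_def)
      then have "(\<Sum>i\<in>I (\<sigma> q). \<psi> (\<sigma> q, i) * \<alpha> q i) \<noteq> (\<Sum>i\<in>I (\<rho> q). \<psi> (\<rho> q, i) * \<beta> q i)"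
        by (simp add: E)
      then show "\<exists>q\<in>Q. (\<Sum>i\<in>I (\<sigma> q). \<phi> (\<sigma> q) i * \<alpha> q i) \<noteq> (\<Sum>i\<in>I (\<rho> q). \<phi> (\<rho> q) i * \<beta> q i)"
        using q \<sigma> \<rho> \<psi> by (intro bexI[of _ q]) (simp_all cong: sum.cong)
    qed
  qed
qed

section \<open>Dominating sets in graphs without isolated vertices\<close>

text \<open>Ore's theorem: both a minimal dominating set and its complement are dominating.\<close>
lemma large_codominating_set:
  fixes V :: "'v set" and R :: "'v \<Rightarrow> 'v \<Rightarrow> bool"
  assumes "finite V" and sym: "\<And>v w. R v w \<Longrightarrow> R w v"
    and nbr: "\<And>v. v \<in> V \<Longrightarrow> \<exists>w\<in>V. w \<noteq> v \<and> R v w"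
  obtains Z where "Z \<subseteq> V" "card V \<le> 2 * card Z" "\<And>z. z \<in> Z \<Longrightarrow> \<exists>w\<in>V - Z. R z w"
proof -
  define dom where "dom D \<longleftrightarrow> D \<subseteq> V \<and> (\<forall>v\<in>V - D. \<exists>w\<in>D. R v w)" for D
  have "dom V" by (simp add: dom_def)
  then obtain D where D: "dom D" and min: "\<And>D'. dom D' \<Longrightarrow> card D \<le> card D'"
    using ex_has_least_nat[of dom V card] by blast
  have DV: "D \<subseteq> V" using D by (simp add: dom_def)
  have finD: "finite D" using DV assms(1) finite_subset by blast
  \<comment> \<open>A vertex of \<open>D\<close> without neighbours outside \<open>D\<close> could
    be dropped: by \<open>nbr\<close> another member of \<open>D\<close> dominates it, and by
    symmetry it dominates nothing outside \<open>D\<close>.\<close>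
  have co: "\<exists>w\<in>V - D. R v w" if v: "v \<in> D" for v
  proof (rule ccontr)
    assume no: "\<not> (\<exists>w\<in>V - D. R v w)"
    have "dom (D - {v})" unfolding dom_def
    proof (intro conjI ballI)
      show "D - {v} \<subseteq> V" using DV by blast
      fix x assume x: "x \<in> V - (D - {v})"
      show "\<exists>w\<in>D - {v}. R x w"
      proof (cases "x = v")
        case True
        then show ?thesis using nbr[of v] no v DV by blast
      next
        case False
        then obtain w where "w \<in> D" "R x w" using x D by (auto simp: dom_def)
        then show ?thesis using no x False sym by blast
      qed
    qed
    then have "card D \<le> card (D - {v})" by (rule min)
    then show False using card_Diff1_less[OF finD v] by simp
  qed
  have "card V = card D + card (V - D)"
    using DV assms(1) finD by (metis card_Diff_subset card_mono le_add_diff_inverse)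
  then consider "card V \<le> 2 * card D" | "card V \<le> 2 * card (V - D)" by linarith
  then show ?thesis
  proof cases
    case 1
    then show ?thesis using that[of D] DV co by blast
  next
    case 2
    have "V - (V - D) = D" using DV by blast
    then show ?thesis using that[of "V - D"] 2 D by (auto simp: dom_def)
  qed
qed

section \<open>Covering dimension, partitions of unity and extension of functions\<close>

text \<open>An open cover of the closed set \<open>K\<close> becomes one of \<open>T\<close> after
  extending its members and adding the complement of \<open>K\<close>; a refinement of bounded order
  is then traced back to \<open>K\<close>.\<close>

lemma covering_dim_le_closedin:
  assumes "covering_dim_le T n" "closedin T K"
  shows "covering_dim_le (subtopology T K) n"
  unfolding covering_dim_le_def
proof (intro allI impI)
  have KT: "K \<subseteq> topspace T" using assms(2) by (rule closedin_subset)
  then have tsK: "topspace (subtopology T K) = K" by (simp add: Int_absorb1)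
  fix \<U> assume "finite \<U> \<and> (\<forall>U\<in>\<U>. openin (subtopology T K) U) \<and> \<Union> \<U> = topspace (subtopology T K)"
  then have fin: "finite \<U>" and op: "\<And>U. U \<in> \<U> \<Longrightarrow> openin (subtopology T K) U" and un: "\<Union>\<U> = K"
    using tsK by auto
  have "\<forall>U\<in>\<U>. \<exists>W. openin T W \<and> U = W \<inter> K" using op by (simp add: openin_subtopology)
  then obtain W where W: "\<And>U. U \<in> \<U> \<Longrightarrow> openin T (W U) \<and> U = W U \<inter> K" by metis
  let ?\<W> = "insert (topspace T - K) (W ` \<U>)"
  have "finite ?\<W>" using fin by simp
  moreover have op\<W>: "\<forall>U\<in>?\<W>. openin T U" using W assms(2) by (auto simp: openin_diff)
  moreover have "\<Union>?\<W> = topspace T"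
  proof
    show "\<Union>?\<W> \<subseteq> topspace T" using op\<W> by (meson Sup_least openin_subset)
    have "K \<subseteq> \<Union>(W ` \<U>)" unfolding un[symmetric] using W by fast
    then show "topspace T \<subseteq> \<Union>?\<W>" by auto
  qed
  ultimately have "\<exists>\<V>. finite \<V> \<and> (\<forall>V\<in>\<V>. openin T V) \<and> \<Union>\<V> = topspace T \<and>
      (\<forall>V\<in>\<V>. \<exists>U\<in>?\<W>. V \<subseteq> U) \<and> (\<forall>x\<in>topspace T. card {V \<in> \<V>. x \<in> V} \<le> n + 1)"
    using assms(1)[unfolded covering_dim_le_def, rule_format, of ?\<W>] by simp
  then obtain \<V> where "finite \<V> \<and> (\<forall>V\<in>\<V>. openin T V) \<and> \<Union>\<V> = topspace T \<and>
      (\<forall>V\<in>\<V>. \<exists>U\<in>?\<W>. V \<subseteq> U) \<and> (\<forall>x\<in>topspace T. card {V \<in> \<V>. x \<in> V} \<le> n + 1)"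
    by (rule exE)
  then have \<V>: "finite \<V>" "\<And>V. V \<in> \<V> \<Longrightarrow> openin T V" "\<Union>\<V> = topspace T"
    "\<And>V. V \<in> \<V> \<Longrightarrow> \<exists>U\<in>?\<W>. V \<subseteq> U" "\<And>x. x \<in> topspace T \<Longrightarrow> card {V \<in> \<V>. x \<in> V} \<le> n + 1"
    by simp_all
  \<comment> \<open>Empty traces are dropped: they can come from members that lie only in the
    complement of \<open>K\<close>, and if \<open>\<U>\<close> is empty nothing contains
    them.\<close>
  let ?\<V>' = "(\<lambda>V. V \<inter> K) ` \<V> - {{}}"
  have refines: "\<exists>U\<in>\<U>. V \<subseteq> U" if "V \<in> ?\<V>'" for V
  proof -
    from that obtain V0 where V0: "V0 \<in> \<V>" "V = V0 \<inter> K" "V \<noteq> {}" by auto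
    obtain U where U: "U \<in> ?\<W>" "V0 \<subseteq> U" using \<V>(4)[OF V0(1)] by blast
    moreover have "U \<noteq> topspace T - K" using U V0 by blast
    ultimately obtain U0 where U0: "U0 \<in> \<U>" "U = W U0" by blast
    have "V \<subseteq> W U0 \<inter> K" using V0(2) U(2) U0(2) by blast
    then have "V \<subseteq> U0" using conjunct2[OF W[OF U0(1)]] by blast
    then show ?thesis using U0(1) by blast
  qed
  have order: "card {V \<in> ?\<V>'. x \<in> V} \<le> n + 1" if "x \<in> K" for x
  proof -
    have "{V \<in> ?\<V>'. x \<in> V} \<subseteq> (\<lambda>V. V \<inter> K) ` {V \<in> \<V>. x \<in> V}" by blast
    then have "card {V \<in> ?\<V>'. x \<in> V} \<le> card {V \<in> \<V>. x \<in> V}"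
      using \<V>(1) by (intro surj_card_le) simp_all
    also have "\<dots> \<le> n + 1" by (rule \<V>(5)[OF subsetD[OF KT that]])
    finally show ?thesis .
  qed
  have covers: "\<Union>?\<V>' = K"
  proof -
    have "\<Union>?\<V>' = (\<Union>\<V>) \<inter> K" by auto
    then show ?thesis using \<V>(3) KT by auto
  qed
  have opens: "\<forall>V\<in>?\<V>'. openin (subtopology T K) V"
    using \<V>(2) by (auto simp: openin_subtopology)
  have "finite ?\<V>' \<and> (\<forall>V\<in>?\<V>'. openin (subtopology T K) V) \<and> \<Union>?\<V>' = K \<and>
      (\<forall>V\<in>?\<V>'. \<exists>U\<in>\<U>. V \<subseteq> U) \<and> (\<forall>x\<in>K. card {V \<in> ?\<V>'. x \<in> V} \<le> n + 1)"
    by (intro conjI ballI finite_Diff finite_imageI \<V>(1) bspec[OF opens] covers refines order)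
  then show "\<exists>\<V>. finite \<V> \<and> (\<forall>V\<in>\<V>. openin (subtopology T K) V) \<and>
      \<Union> \<V> = topspace (subtopology T K) \<and> (\<forall>V\<in>\<V>. \<exists>U\<in>\<U>. V \<subseteq> U) \<and>
      (\<forall>x\<in>topspace (subtopology T K). card {V \<in> \<V>. x \<in> V} \<le> n + 1)"
    unfolding tsK by (rule exI)
qed

text \<open>A real upper bound excludes the value \<infinity>, which stands for an empty set of
  bounds, and a nonempty set in \<open>enat\<close> attains its infimum.\<close>

lemma covering_dim_attained:
  assumes "ereal_of_enat (covering_dim T) < ereal b"
  obtains n where "covering_dim_le T n" "real n < b"
proof -
  let ?S = "{enat n |n. covering_dim_le T n}"
  have "?S \<noteq> {}"
  proof
    assume "?S = {}"
    then have "covering_dim T = \<infinity>" unfolding covering_dim_def by (simp only: Inf_empty top_enat_def)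
    then show False using assms by simp
  qed
  then have "Inf ?S \<in> ?S" unfolding Inf_enat_def by (auto intro: LeastI)
  then obtain n where n: "covering_dim T = enat n" "covering_dim_le T n"
    unfolding covering_dim_def by blast
  then show ?thesis using assms that by auto
qed

text \<open>The function is the distance to the complement of \<open>U\<close>. The whole space is
  treated separately, because there the infimum would run over the empty set.\<close>

lemma openin_eq_positive_set:
  assumes "metrizable_space T" "openin T U"
  obtains f :: "'a \<Rightarrow> real" where "continuous_map T euclideanreal f"
    "\<And>x. x \<in> topspace T \<Longrightarrow> 0 \<le> f x" "\<And>x. x \<in> topspace T \<Longrightarrow> 0 < f x \<longleftrightarrow> x \<in> U"
proof -
  obtain M d where Md: "Metric_space M d" "T = Metric_space.mtopology M d"
    using assms(1) metrizable_space_def by blast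
  interpret Metric_space M d by (rule Md(1))
  have T: "T = mtopology" by (rule Md(2))
  show ?thesis
  proof (cases "U = M")
    case True
    then show ?thesis using that[of "\<lambda>_. 1"] by (simp add: T)
  next
    case False
    have UM: "U \<subseteq> M" using openin_subset[OF assms(2)] by (simp add: T)
    then have ne: "M - U \<noteq> {}" using False by blast
    define f where "f x = (INF z\<in>M - U. d x z)" for x
    have bdd: "bdd_below ((\<lambda>z. d x z) ` (M - U))" for x
      by (rule bdd_belowI[of _ 0]) auto
    have nonneg: "0 \<le> f x" for x unfolding f_def by (rule cINF_greatest[OF ne]) auto
    have lip: "f x \<le> d x y + f y" if "x \<in> M" "y \<in> M" for x y
    proof -
      have "f x - d x y \<le> d y z" if z: "z \<in> M - U" for z
      proof -
        have "f x \<le> d x z" unfolding f_def using bdd z by (rule cINF_lower)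
        also have "\<dots> \<le> d x y + d y z" using \<open>x \<in> M\<close> \<open>y \<in> M\<close> z triangle by blast
        finally show ?thesis by simp
      qed
      then have "f x - d x y \<le> f y" unfolding f_def[of y] by (intro cINF_greatest[OF ne])
      then show ?thesis by simp
    qed
    have "continuous_map mtopology euclideanreal f"
    proof -
      have "\<exists>W. openin mtopology W \<and> x \<in> W \<and> (\<forall>y\<in>W. f y \<in> ball (f x) e)"
        if x: "x \<in> M" and e: "e > 0" for x e
      proof (intro exI[of _ "mball x e"] conjI ballI)
        fix y assume "y \<in> mball x e"
        then have y: "y \<in> M" "d x y < e" by auto
        then show "f y \<in> ball (f x) e"
          using lip[OF x y(1)] lip[OF y(1) x] by (simp add: dist_real_def commute[of y x] abs_less_iff)
      qed (use x e in auto)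
      then show ?thesis
        using Met_TC.continuous_map_to_metric[of mtopology f] by simp
    qed
    moreover have "0 < f x \<longleftrightarrow> x \<in> U" if x: "x \<in> M" for x
    proof
      assume "0 < f x"
      show "x \<in> U"
      proof (rule ccontr)
        assume "x \<notin> U"
        then have "f x \<le> d x x" unfolding f_def using x by (intro cINF_lower[OF bdd]) auto
        then show False using \<open>0 < f x\<close> x by simp
      qed
    next
      assume "x \<in> U"
      then obtain r where r: "r > 0" "mball x r \<subseteq> U"
        using assms(2) by (auto simp: T openin_mtopology)
      have "r \<le> f x" unfolding f_def
        by (rule cINF_greatest[OF ne]) (use r x in force)
      then show "0 < f x" using r by simp
    qed
    ultimately show ?thesis using that[of f] nonneg by (simp add: T)
  qed
qed

text \<open>Normalised functions from \<open>openin_eq_positive_set\<close>. Each is nonzero exactly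
  on its member, so a bound on the order of the cover is a bound on the number of nonzero weights,
  as \<open>generic_coefficients\<close> requires.\<close>

lemma partition_of_unity_exact_support:
  assumes T: "metrizable_space T" and fin: "finite \<V>" and op: "\<And>V. V \<in> \<V> \<Longrightarrow> openin T V"
    and un: "\<Union>\<V> = topspace T"
  obtains \<phi> :: "'a set \<Rightarrow> 'a \<Rightarrow> real"
  where "\<And>V. V \<in> \<V> \<Longrightarrow> continuous_map T euclideanreal (\<phi> V)"
    and "\<And>V x. V \<in> \<V> \<Longrightarrow> x \<in> topspace T \<Longrightarrow> 0 \<le> \<phi> V x \<and> (\<phi> V x \<noteq> 0 \<longleftrightarrow> x \<in> V)"
    and "\<And>x. x \<in> topspace T \<Longrightarrow> (\<Sum>V\<in>\<V>. \<phi> V x) = 1"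
proof -
  have "\<forall>V\<in>\<V>. \<exists>f::'a\<Rightarrow>real. continuous_map T euclideanreal f \<and>
     (\<forall>x\<in>topspace T. 0 \<le> f x \<and> (0 < f x \<longleftrightarrow> x \<in> V))"
    using openin_eq_positive_set[OF T op] by metis
  then obtain f :: "'a set \<Rightarrow> 'a \<Rightarrow> real" where
    f: "\<And>V. V \<in> \<V> \<Longrightarrow> continuous_map T euclideanreal (f V)"
    "\<And>V x. V \<in> \<V> \<Longrightarrow> x \<in> topspace T \<Longrightarrow> 0 \<le> f V x \<and> (0 < f V x \<longleftrightarrow> x \<in> V)" by metis
  define s where "s x = (\<Sum>V\<in>\<V>. f V x)" for x
  have s: "s x > 0" if "x \<in> topspace T" for x
  proof -
    from that obtain V where V: "V \<in> \<V>" "x \<in> V" using un by blast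
    then have "f V x > 0" using f(2) that by blast
    then show ?thesis unfolding s_def using V fin f(2) that by (intro sum_pos2[of _ V]) auto
  qed
  have s_cont: "continuous_map T euclideanreal s"
    unfolding s_def using fin f(1) by (intro continuous_map_sum) auto
  show ?thesis
  proof (rule that[of "\<lambda>V x. f V x / s x"])
    show "continuous_map T euclideanreal (\<lambda>x. f V x / s x)" if "V \<in> \<V>" for V
      using that f(1) s s_cont by (intro continuous_map_real_divide) force+
    show "0 \<le> f V x / s x \<and> (f V x / s x \<noteq> 0 \<longleftrightarrow> x \<in> V)" if "V \<in> \<V>" "x \<in> topspace T" for V x
      using s[OF that(2)] f(2)[OF that] by auto
    show "(\<Sum>V\<in>\<V>. f V x / s x) = 1" if "x \<in> topspace T" for x
      using s[OF that] by (simp add: s_def sum_divide_distrib[symmetric])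
  qed
qed

lemma continuous_map_vec_lambda:
  fixes f :: "'k::finite \<Rightarrow> 'a \<Rightarrow> real"
  assumes "\<And>k. continuous_map X euclideanreal (f k)"
  shows "continuous_map X euclidean (\<lambda>x. \<chi> k. f k x)"
  unfolding continuous_map_atin limitin_canonical_iff
proof
  fix x assume "x \<in> topspace X"
  then have "((f k) \<longlongrightarrow> f k x) (atin X x)" for k
    using assms unfolding continuous_map_atin limitin_canonical_iff by blast
  then show "((\<lambda>x. \<chi> k. f k x) \<longlongrightarrow> (\<chi> k. f k x)) (atin X x)"
    by (intro vec_tendstoI) simp
qed

lemma continuous_map_vec_nth:
  fixes f :: "'a \<Rightarrow> real ^ 'k"
  assumes "continuous_map X euclidean f"
  shows "continuous_map X euclideanreal (\<lambda>x. f x $ k)"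
  using assms unfolding continuous_map_atin limitin_canonical_iff by (simp add: tendsto_vec_nth)

lemma continuous_injection_inverse:
  assumes "continuous_map S Y G" "compact_space S" "Hausdorff_space Y" "inj_on G (topspace S)"
  obtains H where "continuous_map (subtopology Y (G ` topspace S)) S H"
    "\<And>x. x \<in> topspace S \<Longrightarrow> H (G x) = x"
proof -
  have "embedding_map S Y G" using assms by (rule continuous_imp_embedding_map)
  then obtain H where "homeomorphic_maps S (subtopology Y (G ` topspace S)) G H"
    unfolding embedding_map_def homeomorphic_map_maps by blast
  then show ?thesis using that[of H] by (auto simp: homeomorphic_maps_def)
qed

text \<open>Smallness is measured by the oscillation of the given functions instead of a diameter,
  since the perturbation uses nothing else. Compactness supplies the finite cover to be refined; the
  members are kept nonempty so that each has a sample point.\<close>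

lemma fine_cover_of_bounded_order:
  fixes h :: "'j \<Rightarrow> 'a \<Rightarrow> real"
  assumes "compact_space S" "covering_dim_le S n" "finite J" "\<delta> > 0"
    and cont: "\<And>j. j \<in> J \<Longrightarrow> continuous_map S euclideanreal (h j)"
  obtains \<V> where "finite \<V>" "\<And>V. V \<in> \<V> \<Longrightarrow> openin S V \<and> V \<noteq> {}" "\<Union>\<V> = topspace S"
    "\<And>x. x \<in> topspace S \<Longrightarrow> card {V \<in> \<V>. x \<in> V} \<le> n + 1"
    "\<And>V x y j. V \<in> \<V> \<Longrightarrow> x \<in> V \<Longrightarrow> y \<in> V \<Longrightarrow> j \<in> J \<Longrightarrow> \<bar>h j x - h j y\<bar> < \<delta>"
proof -
  define U where "U z = topspace S \<inter> (\<Inter>j\<in>J. {x \<in> topspace S. h j x \<in> ball (h j z) (\<delta> / 2)})" for z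
  have opU: "openin S (U z)" for z
  proof (cases "J = {}")
    case False
    have "openin S {x \<in> topspace S. h j x \<in> ball (h j z) (\<delta> / 2)}" if "j \<in> J" for j
      using cont[OF that] by (rule openin_continuous_map_preimage) simp
    then show ?thesis unfolding U_def using assms(3) False by (intro openin_Int openin_INT2) auto
  qed (simp add: U_def)
  have zU: "z \<in> U z" if "z \<in> topspace S" for z using that assms(4) by (auto simp: U_def)
  have "topspace S \<subseteq> \<Union>(U ` topspace S)" using zU by blast
  moreover have "\<forall>W\<in>U ` topspace S. openin S W" using opU by blast
  ultimately obtain \<F> where \<F>: "finite \<F>" "\<F> \<subseteq> U ` topspace S" "topspace S \<subseteq> \<Union>\<F>"
    using assms(1) unfolding compact_space_alt by meson
  have "\<forall>W\<in>\<F>. openin S W" using \<F>(2) opU by blast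
  moreover from this have "\<Union>\<F> = topspace S" using \<F>(3) openin_subset by (metis Sup_least subset_antisym)
  ultimately have "\<exists>\<V>. finite \<V> \<and> (\<forall>V\<in>\<V>. openin S V) \<and> \<Union>\<V> = topspace S \<and>
      (\<forall>V\<in>\<V>. \<exists>U\<in>\<F>. V \<subseteq> U) \<and> (\<forall>x\<in>topspace S. card {V \<in> \<V>. x \<in> V} \<le> n + 1)"
    using assms(2)[unfolded covering_dim_le_def, rule_format, of \<F>] \<F>(1) by simp
  then obtain \<V> where \<V>: "finite \<V> \<and> (\<forall>V\<in>\<V>. openin S V) \<and> \<Union>\<V> = topspace S \<and>
      (\<forall>V\<in>\<V>. \<exists>U\<in>\<F>. V \<subseteq> U) \<and> (\<forall>x\<in>topspace S. card {V \<in> \<V>. x \<in> V} \<le> n + 1)"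
    by (rule exE)
  show ?thesis
  proof (rule that[of "\<V> - {{}}"])
    show "finite (\<V> - {{}})" using \<V> by simp
    show "openin S V \<and> V \<noteq> {}" if "V \<in> \<V> - {{}}" for V using \<V> that by blast
    show "\<Union>(\<V> - {{}}) = topspace S" using \<V> by auto
    show "card {V \<in> \<V> - {{}}. x \<in> V} \<le> n + 1" if "x \<in> topspace S" for x
    proof -
      have "{V \<in> \<V> - {{}}. x \<in> V} = {V \<in> \<V>. x \<in> V}" by auto
      then show ?thesis using \<V> that by simp
    qed
    fix V x y j assume V: "V \<in> \<V> - {{}}" and xy: "x \<in> V" "y \<in> V" and j: "j \<in> J"
    obtain W where "W \<in> \<F>" "V \<subseteq> W" using \<V> V by blast
    then obtain z where "V \<subseteq> U z" using \<F>(2) by blast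
    then have "\<bar>h j z - h j x\<bar> < \<delta> / 2" "\<bar>h j z - h j y\<bar> < \<delta> / 2"
      using xy j by (auto simp: U_def dist_real_def)
    then show "\<bar>h j x - h j y\<bar> < \<delta>" by linarith
  qed
qed

text \<open>Tietze's theorem is applied to the error \<open>h v x - f (G v x)\<close> and not to the
  values, so that the extension stays \<delta>-close to \<open>f\<close> everywhere. Compactness and
  injectivity carry the error over to \<open>Y\<close>, and disjointness makes it well defined on
  the union of the images.\<close>

lemma extend_from_disjoint_images:
  fixes f :: "'b \<Rightarrow> real" and h :: "'v \<Rightarrow> 'a \<Rightarrow> real"
  assumes Y: "normal_space Y" "Hausdorff_space Y" and "finite V"
    and f: "continuous_map Y euclideanreal f" "\<And>y. y \<in> topspace Y \<Longrightarrow> f y \<in> {0..1}"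
    and S: "\<And>v. v \<in> V \<Longrightarrow> compact_space (S v)"
    and G: "\<And>v. v \<in> V \<Longrightarrow> continuous_map (S v) Y (G v)"
    and inj: "\<And>v. v \<in> V \<Longrightarrow> inj_on (G v) (topspace (S v))"
    and disj: "\<And>v w. v \<in> V \<Longrightarrow> w \<in> V \<Longrightarrow> v \<noteq> w \<Longrightarrow> G v ` topspace (S v) \<inter> G w ` topspace (S w) = {}"
    and h: "\<And>v. v \<in> V \<Longrightarrow> continuous_map (S v) euclideanreal (h v)"
    and h01: "\<And>v x. v \<in> V \<Longrightarrow> x \<in> topspace (S v) \<Longrightarrow> h v x \<in> {0..1}"
    and close: "\<And>v x. v \<in> V \<Longrightarrow> x \<in> topspace (S v) \<Longrightarrow> \<bar>h v x - f (G v x)\<bar> \<le> \<delta>"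
    and "0 \<le> \<delta>"
  obtains f' where "continuous_map Y euclideanreal f'" "\<And>y. y \<in> topspace Y \<Longrightarrow> f' y \<in> {0..1}"
    "\<And>y. y \<in> topspace Y \<Longrightarrow> \<bar>f' y - f y\<bar> \<le> \<delta>"
    "\<And>v x. v \<in> V \<Longrightarrow> x \<in> topspace (S v) \<Longrightarrow> f' (G v x) = h v x"
proof -
  define D where "D v = G v ` topspace (S v)" for v
  define C where "C = (\<Union>v\<in>V. D v)"
  have GY: "G v x \<in> topspace Y" if "v \<in> V" "x \<in> topspace (S v)" for v x
    using G that by (meson continuous_map_image_subset_topspace image_subset_iff)
  have clD: "closedin Y (D v)" if "v \<in> V" for v
    unfolding D_def using S[OF that] G[OF that] Y(2)
    by (intro compactin_imp_closedin image_compactin[of "S v"]) (auto simp: compact_space_def)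
  then have clC: "closedin Y C" unfolding C_def using assms(3) by (intro closedin_Union) auto
  have "\<exists>H. continuous_map (subtopology Y (D v)) (S v) H \<and> (\<forall>x\<in>topspace (S v). H (G v x) = x)"
    if "v \<in> V" for v
    unfolding D_def
    by (rule continuous_injection_inverse[OF G[OF that] S[OF that] Y(2) inj[OF that]]) blast
  then obtain H where H: "\<And>v. v \<in> V \<Longrightarrow> continuous_map (subtopology Y (D v)) (S v) (H v)"
    "\<And>v x. v \<in> V \<Longrightarrow> x \<in> topspace (S v) \<Longrightarrow> H v (G v x) = x" by metis
  define e0 where "e0 v y = h v (H v y) - f y" for v y
  obtain e where e: "continuous_map (subtopology Y C) euclideanreal e"
    "\<And>y v. v \<in> V \<Longrightarrow> y \<in> topspace (subtopology Y C) \<inter> D v \<Longrightarrow> e y = e0 v y"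
  proof -
    note obt = that
    show thesis
    proof (rule pasting_lemma_exists_closed[where X = "subtopology Y C" and I = V and T = D and f = e0 and Y = euclideanreal])
      show "finite V" by fact
      show "topspace (subtopology Y C) \<subseteq> \<Union> (D ` V)" by (auto simp: C_def)
      show "closedin (subtopology Y C) (D v)" if "v \<in> V" for v
        using clD[OF that] that by (intro closedin_subset_topspace) (auto simp: C_def)
      show "continuous_map (subtopology (subtopology Y C) (D v)) euclideanreal (e0 v)" if "v \<in> V" for v
      proof -
        have "subtopology (subtopology Y C) (D v) = subtopology Y (D v)"
          using that by (simp add: subtopology_subtopology C_def Int_absorb1 UN_upper)
        moreover have "continuous_map (subtopology Y (D v)) euclideanreal (\<lambda>y. h v (H v y))"
          using continuous_map_compose[OF H(1)[OF that] h[OF that]] by (simp add: o_def)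
        ultimately show ?thesis unfolding e0_def
          using f(1) by (simp add: continuous_map_diff continuous_map_from_subtopology)
      qed
      show "e0 v y = e0 w y" if "v \<in> V" "w \<in> V" "y \<in> topspace (subtopology Y C) \<inter> D v \<inter> D w" for v w y
        using disj[OF that(1,2)] that(3) by (cases "v = w") (auto simp: D_def)
      show thesis if "continuous_map (subtopology Y C) euclideanreal g"
        "\<And>y v. v \<in> V \<Longrightarrow> y \<in> topspace (subtopology Y C) \<inter> D v \<Longrightarrow> g y = e0 v y" for g
        by (rule obt[OF that])
    qed
  qed
  have eG: "e (G v x) = h v x - f (G v x)" if "v \<in> V" "x \<in> topspace (S v)" for v x
  proof -
    have "G v x \<in> topspace (subtopology Y C) \<inter> D v" using that GY by (auto simp: C_def D_def)
    then show ?thesis using e(2) that H(2) by (simp add: e0_def)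
  qed
  have "e ` C \<subseteq> {-\<delta>..\<delta>}"
    using eG close by (fastforce simp: C_def D_def abs_le_iff)
  then obtain e' where e': "continuous_map Y euclideanreal e'" "\<And>y. y \<in> C \<Longrightarrow> e' y = e y"
    "e' ` topspace Y \<subseteq> {-\<delta>..\<delta>}"
    using Tietze_extension_closed_real_interval[OF Y(1) clC e(1), of "-\<delta>" \<delta>] \<open>0 \<le> \<delta>\<close> by auto
  show ?thesis
  \<comment> \<open>Clamping to [0,1] cannot increase the distance to \<open>f\<close>, whose values
    lie there, and it does not alter the prescribed values \<open>h v x\<close>.\<close>
  proof (rule that[of "\<lambda>y. max 0 (min 1 (f y + e' y))"])
    show "continuous_map Y euclideanreal (\<lambda>y. max 0 (min 1 (f y + e' y)))"
      using f(1) e'(1) by (intro continuous_intros) auto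
    show "max 0 (min 1 (f y + e' y)) \<in> {0..1}" for y by auto
    show "\<bar>max 0 (min 1 (f y + e' y)) - f y\<bar> \<le> \<delta>" if "y \<in> topspace Y" for y
    proof -
      have "-\<delta> \<le> e' y" "e' y \<le> \<delta>" using e'(3) that by auto
      then show ?thesis using f(2)[OF that] by (auto simp: max_def min_def)
    qed
    show "max 0 (min 1 (f (G v x) + e' (G v x))) = h v x" if v: "v \<in> V" "x \<in> topspace (S v)" for v x
    proof -
      have "G v x \<in> C" using v by (auto simp: C_def D_def)
      then have "f (G v x) + e' (G v x) = h v x" using e'(2) eG[OF v] by simp
      then show ?thesis using h01[OF v] by (auto simp: max_def min_def)
    qed
  qed
qed

lemma convex_sum_bounds:
  fixes \<phi> c :: "'i \<Rightarrow> real"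
  assumes "finite I" "\<And>i. i \<in> I \<Longrightarrow> 0 \<le> \<phi> i" "sum \<phi> I = 1"
    and "\<And>i. i \<in> I \<Longrightarrow> \<phi> i \<noteq> 0 \<Longrightarrow> c i \<in> {l..u}"
  shows "(\<Sum>i\<in>I. \<phi> i * c i) \<in> {l..u}"
proof -
  have "(\<Sum>i\<in>I. \<phi> i * l) \<le> (\<Sum>i\<in>I. \<phi> i * c i)"
    using assms(2,4) by (intro sum_mono) (metis atLeastAtMost_iff mult_left_mono mult_zero_left order_refl)
  moreover have "(\<Sum>i\<in>I. \<phi> i * c i) \<le> (\<Sum>i\<in>I. \<phi> i * u)"
    using assms(2,4) by (intro sum_mono) (metis atLeastAtMost_iff mult_left_mono mult_zero_left order_refl)
  ultimately show ?thesis using assms(3) by (simp add: sum_distrib_right[symmetric])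
qed

section \<open>Perturbing a map along finitely many disjoint pieces\<close>

text \<open>\<open>R\<close> is the graph of demanded inequalities. It has no isolated vertices, so at least half of the
  vertices can be joined to distinct other vertices \<open>p z\<close> outside this half. The coefficients at the
  vertices \<open>z \<in> Z\<close> are then chosen generically against the fixed ones at \<open>p z\<close>.\<close>
lemma perturb_to_separate:
  fixes f :: "'b \<Rightarrow> real ^ 'r" and S :: "'t \<Rightarrow> 'a topology" and G :: "'v \<Rightarrow> 'a \<Rightarrow> 'b"
  assumes Y: "normal_space Y" "Hausdorff_space Y"
    and f: "continuous_map Y euclidean f" "f ` topspace Y \<subseteq> unit_cube"
    and T: "finite T" "\<And>t. t \<in> T \<Longrightarrow> compact_space (S t)" "\<And>t. t \<in> T \<Longrightarrow> metrizable_space (S t)"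
      "\<And>t. t \<in> T \<Longrightarrow> covering_dim_le (S t) (d t)"
    and V: "finite V" "\<And>v. v \<in> V \<Longrightarrow> \<tau> v \<in> T"
    and G: "\<And>v. v \<in> V \<Longrightarrow> continuous_map (S (\<tau> v)) Y (G v)"
    and inj: "\<And>v. v \<in> V \<Longrightarrow> inj_on (G v) (topspace (S (\<tau> v)))"
    and disj: "\<And>v w. v \<in> V \<Longrightarrow> w \<in> V \<Longrightarrow> v \<noteq> w \<Longrightarrow>
      G v ` topspace (S (\<tau> v)) \<inter> G w ` topspace (S (\<tau> w)) = {}"
    and sym: "\<And>v w. R v w \<Longrightarrow> R w v"
    and nbr: "\<And>v. v \<in> V \<Longrightarrow> \<exists>w\<in>V. w \<noteq> v \<and> R v w"
    and dim: "2 * (\<Sum>t\<in>T. d t) < CARD('r) * card V" and "\<epsilon> > 0"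
  obtains f' :: "'b \<Rightarrow> real ^ 'r" where "continuous_map Y euclidean f'" "f' ` topspace Y \<subseteq> unit_cube"
    "\<And>y. y \<in> topspace Y \<Longrightarrow> dist (f y) (f' y) \<le> \<epsilon>"
    "\<forall>x. (\<forall>t\<in>T. x t \<in> topspace (S t)) \<longrightarrow>
      (\<exists>v\<in>V. \<exists>w\<in>V. R v w \<and> f' (G v (x (\<tau> v))) \<noteq> f' (G w (x (\<tau> w))))"
proof -
  obtain Z where Z: "Z \<subseteq> V" "card V \<le> 2 * card Z" "\<And>z. z \<in> Z \<Longrightarrow> \<exists>w\<in>V - Z. R z w"
    using large_codominating_set[OF V(1) sym nbr] by blast
  then obtain p where p: "\<And>z. z \<in> Z \<Longrightarrow> p z \<in> V - Z \<and> R z (p z)" by metis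
  \<comment> \<open>Each coordinate moves by at most \<open>2 * \<delta>\<close>: one \<delta> for
    the oscillation on a member of the cover and one for the choice of coefficients. The sum over
    all coordinates is then at most \<epsilon>.\<close>
  define \<delta> where "\<delta> = \<epsilon> / (2 * CARD('r))"
  have \<delta>: "\<delta> > 0" using \<open>\<epsilon> > 0\<close> by (simp add: \<delta>_def)
  define F where "F = (\<lambda>(v, k) x. f (G v x) $ k)"
  have F_cont: "continuous_map (S (\<tau> v)) euclideanreal (F (v, k))" if "v \<in> V" for v k
    using continuous_map_compose[OF G[OF that] continuous_map_vec_nth[OF f(1), of k]]
    by (simp add: F_def o_def)
  have F01: "F (v, k) x \<in> {0..1}" if "v \<in> V" "x \<in> topspace (S (\<tau> v))" for v k x
  proof -
    have "G v x \<in> topspace Y"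
      using G that by (meson continuous_map_image_subset_topspace image_subset_iff)
    then have "f (G v x) \<in> unit_cube" using f(2) by blast
    then show ?thesis by (simp add: F_def unit_cube_def)
  qed
  define good where "good t \<V> \<longleftrightarrow> finite \<V> \<and> (\<forall>W\<in>\<V>. openin (S t) W \<and> W \<noteq> {}) \<and> \<Union>\<V> = topspace (S t) \<and>
     (\<forall>x\<in>topspace (S t). card {W \<in> \<V>. x \<in> W} \<le> d t + 1) \<and>
     (\<forall>W\<in>\<V>. \<forall>x\<in>W. \<forall>y\<in>W. \<forall>j\<in>{v\<in>V. \<tau> v = t} \<times> UNIV. \<bar>F j x - F j y\<bar> < \<delta>)" for t \<V>
  have "\<exists>\<V>. good t \<V>" if t: "t \<in> T" for t
  proof -
    have "finite ({v\<in>V. \<tau> v = t} \<times> (UNIV :: 'r set))" using V(1) by simp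
    moreover have "continuous_map (S t) euclideanreal (F j)" if "j \<in> {v\<in>V. \<tau> v = t} \<times> UNIV" for j
      using that F_cont by auto
    ultimately show ?thesis unfolding good_def
      by (rule fine_cover_of_bounded_order[where h = F, OF T(2)[OF t] T(4)[OF t] _ \<delta>])
        (assumption | (rule exI, intro conjI ballI; (assumption | blast | simp)))+
  qed
  then have "\<forall>t\<in>T. \<exists>\<V>. good t \<V>" by (rule ballI)
  from bchoice[OF this] obtain \<V> where good\<V>: "\<forall>t\<in>T. good t (\<V> t)" by (rule exE)
  have \<V>: "finite (\<V> t)" "\<And>W. W \<in> \<V> t \<Longrightarrow> openin (S t) W" "\<And>W. W \<in> \<V> t \<Longrightarrow> W \<noteq> {}"
    "\<Union>(\<V> t) = topspace (S t)" "\<And>x. x \<in> topspace (S t) \<Longrightarrow> card {W \<in> \<V> t. x \<in> W} \<le> d t + 1"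
    "\<forall>W\<in>\<V> t. \<forall>x\<in>W. \<forall>y\<in>W. \<forall>j\<in>{v\<in>V. \<tau> v = t} \<times> UNIV. \<bar>F j x - F j y\<bar> < \<delta>" if "t \<in> T" for t
    using bspec[OF good\<V> that] unfolding good_def by simp_all
  have osc: "\<bar>F (v, k) x - F (v, k) y\<bar> < \<delta>" if "v \<in> V" "W \<in> \<V> (\<tau> v)" "x \<in> W" "y \<in> W" for v k W x y
    using \<V>(6)[OF V(2)[OF that(1)]] that by blast
  have "\<forall>t\<in>T. \<exists>\<phi>. (\<forall>W\<in>\<V> t. continuous_map (S t) euclideanreal (\<phi> W)) \<and>
     (\<forall>W\<in>\<V> t. \<forall>x\<in>topspace (S t). 0 \<le> \<phi> W x \<and> (\<phi> W x \<noteq> 0 \<longleftrightarrow> x \<in> W)) \<and>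
     (\<forall>x\<in>topspace (S t). (\<Sum>W\<in>\<V> t. \<phi> W x) = (1::real))"
  proof
    fix t assume t: "t \<in> T"
    show "\<exists>\<phi>. (\<forall>W\<in>\<V> t. continuous_map (S t) euclideanreal (\<phi> W)) \<and>
     (\<forall>W\<in>\<V> t. \<forall>x\<in>topspace (S t). 0 \<le> \<phi> W x \<and> (\<phi> W x \<noteq> 0 \<longleftrightarrow> x \<in> W)) \<and>
     (\<forall>x\<in>topspace (S t). (\<Sum>W\<in>\<V> t. \<phi> W x) = (1::real))"
      by (rule partition_of_unity_exact_support[OF T(3)[OF t] \<V>(1)[OF t] \<V>(2)[OF t] \<V>(4)[OF t]])
        blast+
  qed
  from bchoice[OF this] obtain \<phi> where \<phi>0: "\<forall>t\<in>T. (\<forall>W\<in>\<V> t. continuous_map (S t) euclideanreal (\<phi> t W)) \<and>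
     (\<forall>W\<in>\<V> t. \<forall>x\<in>topspace (S t). 0 \<le> \<phi> t W x \<and> (\<phi> t W x \<noteq> 0 \<longleftrightarrow> x \<in> W)) \<and>
     (\<forall>x\<in>topspace (S t). (\<Sum>W\<in>\<V> t. \<phi> t W x) = (1::real))" by (rule exE)
  have \<phi>: "\<And>t W. t \<in> T \<Longrightarrow> W \<in> \<V> t \<Longrightarrow> continuous_map (S t) euclideanreal (\<phi> t W)"
    "\<And>t W x. t \<in> T \<Longrightarrow> W \<in> \<V> t \<Longrightarrow> x \<in> topspace (S t) \<Longrightarrow> 0 \<le> \<phi> t W x \<and> (\<phi> t W x \<noteq> 0 \<longleftrightarrow> x \<in> W)"
    "\<And>t x. t \<in> T \<Longrightarrow> x \<in> topspace (S t) \<Longrightarrow> (\<Sum>W\<in>\<V> t. \<phi> t W x) = (1::real)"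
    using \<phi>0 by blast+
  define c where "c W = (SOME x. x \<in> W)" for W :: "'a set"
  have cW: "c W \<in> W" if "t \<in> T" "W \<in> \<V> t" for t W
    unfolding c_def using \<V>(3)[OF that] by (simp add: some_in_eq)
  \<comment> \<open>The unperturbed coefficient: a coordinate of \<open>f\<close> along a vertex
    map, taken at a sample point of the member.\<close>
  define tgt where "tgt q W = F q (c W)" for q W
  have tgt01: "tgt (v, k) W \<in> {0..1}" if v: "v \<in> V" "W \<in> \<V> (\<tau> v)" for v k W
  proof -
    have "c W \<in> topspace (S (\<tau> v))"
      using cW[OF V(2)[OF v(1)] v(2)] \<V>(4)[OF V(2)[OF v(1)]] v(2) by blast
    then show ?thesis using F01 v(1) by (simp add: tgt_def)
  qed
  \<comment> \<open>One equation for each vertex of \<open>Z\<close> and each coordinate. As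
    \<open>Z\<close> has at least half of the vertices, \<open>dim\<close> makes the equations
    outnumber the free weights.\<close>
  define Q where "Q = Z \<times> (UNIV :: 'r set)"
  have finZ: "finite Z" using Z(1) V(1) finite_subset by blast
  have "2 * (\<Sum>t\<in>T. d t) < 2 * card Q"
  proof -
    note dim
    also have "CARD('r) * card V \<le> CARD('r) * (2 * card Z)" using Z(2) by (rule mult_le_mono2)
    also have "\<dots> = 2 * card Q" by (simp add: Q_def card_cartesian_product)
    finally show ?thesis .
  qed
  then have dimQ: "(\<Sum>t\<in>T. d t) < card Q" by simp
  obtain \<alpha> where \<alpha>: "\<And>q W. q \<in> Q \<Longrightarrow> W \<in> \<V> (\<tau> (fst q)) \<Longrightarrow>
       max 0 (tgt q W - \<delta>) < \<alpha> q W \<and> \<alpha> q W < min 1 (tgt q W + \<delta>)"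
    and gen: "\<forall>\<psi>. (\<forall>t\<in>T. (\<Sum>W\<in>\<V> t. \<psi> t W) = 1 \<and> card {W \<in> \<V> t. \<psi> t W \<noteq> 0} \<le> d t + 1) \<longrightarrow>
      (\<exists>q\<in>Q. (\<Sum>W\<in>\<V> (\<tau> (fst q)). \<psi> (\<tau> (fst q)) W * \<alpha> q W) \<noteq>
         (\<Sum>W\<in>\<V> (\<tau> (p (fst q))). \<psi> (\<tau> (p (fst q))) W * tgt (p (fst q), snd q) W))"
  proof -
    note obt = that
    show thesis
    \<comment> \<open>Since \<open>p z\<close> lies outside \<open>Z\<close>, the right-hand
      coefficients are known before any \<alpha> is chosen. The box is cut down to [0,1] and stays
      nonempty even for a target at 0 or 1, because \<delta> is positive.\<close>
    proof (rule generic_coefficients[where T = T and I = \<V> and Q = Q and d = d and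
        \<sigma> = "\<lambda>q. \<tau> (fst q)" and \<rho> = "\<lambda>q. \<tau> (p (fst q))" and \<beta> = "\<lambda>q. tgt (p (fst q), snd q)" and
        l = "\<lambda>q W. max 0 (tgt q W - \<delta>)" and u = "\<lambda>q W. min 1 (tgt q W + \<delta>)"])
      show "finite T" by fact
      show "finite (\<V> t)" if "t \<in> T" for t using \<V>(1) that .
      show "finite Q" using finZ by (simp add: Q_def)
      show "\<tau> (fst q) \<in> T" if "q \<in> Q" for q using that Z(1) V(2) by (auto simp: Q_def)
      show "\<tau> (p (fst q)) \<in> T" if "q \<in> Q" for q using that p V(2) by (auto simp: Q_def)
      show "(\<Sum>t\<in>T. d t) < card Q" by (rule dimQ)
      show "max 0 (tgt q W - \<delta>) < min 1 (tgt q W + \<delta>)" if "q \<in> Q" "W \<in> \<V> (\<tau> (fst q))" for q W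
        using tgt01[of "fst q" W "snd q"] that Z(1) \<delta> by (auto simp: Q_def)
    qed (rule obt, assumption+)
  qed
  define a where "a v k W = (if v \<in> Z then \<alpha> (v, k) W else tgt (v, k) W)" for v k W
  have a01: "a v k W \<in> {0..1} \<and> \<bar>a v k W - tgt (v, k) W\<bar> \<le> \<delta>" if "v \<in> V" "W \<in> \<V> (\<tau> v)" for v k W
  proof (cases "v \<in> Z")
    case True
    then have "0 < \<alpha> (v, k) W" "\<alpha> (v, k) W < 1" "tgt (v, k) W - \<delta> < \<alpha> (v, k) W" "\<alpha> (v, k) W < tgt (v, k) W + \<delta>"
      using \<alpha>[of "(v, k)" W] that(2) by (simp_all add: Q_def)
    then show ?thesis using True by (simp add: a_def abs_le_iff)
  qed (use tgt01[OF that, of k] \<delta> in \<open>simp add: a_def\<close>)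
  \<comment> \<open>The prescribed coordinate \<open>k\<close> at vertex \<open>v\<close>. Vertices
    over the same \<open>t\<close> share a partition of unity, so all equations at a point involve
    the same few weights.\<close>
  define h where "h k v x = (\<Sum>W\<in>\<V> (\<tau> v). \<phi> (\<tau> v) W x * a v k W)" for k v x
  have h01: "h k v x \<in> {0..1}" if v: "v \<in> V" "x \<in> topspace (S (\<tau> v))" for k v x
  proof -
    have t: "\<tau> v \<in> T" using V(2) v(1) .
    show ?thesis
      unfolding h_def using \<V>(1)[OF t] _ \<phi>(3)[OF t v(2)]
      by (rule convex_sum_bounds) (simp_all only: \<phi>(2)[OF t _ v(2)] a01[OF v(1)])
  qed
  have hclose: "\<bar>h k v x - f (G v x) $ k\<bar> \<le> 2 * \<delta>" if v: "v \<in> V" "x \<in> topspace (S (\<tau> v))" for k v x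
  proof -
    have t: "\<tau> v \<in> T" using V(2) v by blast
    have "h k v x \<in> {F (v, k) x - 2 * \<delta>..F (v, k) x + 2 * \<delta>}"
      unfolding h_def
    proof (rule convex_sum_bounds)
      fix W assume W: "W \<in> \<V> (\<tau> v)" "\<phi> (\<tau> v) W x \<noteq> 0"
      then have "x \<in> W" using \<phi>(2)[OF t W(1) v(2)] by blast
      then have "\<bar>tgt (v, k) W - F (v, k) x\<bar> < \<delta>"
        unfolding tgt_def using osc[OF v(1) W(1) cW[OF t W(1)]] by blast
      then show "a v k W \<in> {F (v, k) x - 2 * \<delta>..F (v, k) x + 2 * \<delta>}"
        using a01[OF v(1) W(1), of k] by auto
    qed (use \<V>(1) \<phi>(2,3) t v in blast)+
    then show ?thesis by (auto simp: F_def abs_le_iff)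
  qed
  have h_cont: "continuous_map (S (\<tau> v)) euclideanreal (h k v)" if "v \<in> V" for k v
    unfolding h_def using \<V>(1) \<phi>(1) V(2)[OF that]
    by (intro continuous_map_sum continuous_map_real_mult_right) auto
  have fk01: "f y $ k \<in> {0..1}" if "y \<in> topspace Y" for y k
    using f(2) that by (auto simp: unit_cube_def)
  have "\<exists>f'. continuous_map Y euclideanreal f' \<and> (\<forall>y\<in>topspace Y. f' y \<in> {0..1}) \<and>
      (\<forall>y\<in>topspace Y. \<bar>f' y - f y $ k\<bar> \<le> 2 * \<delta>) \<and>
      (\<forall>v\<in>V. \<forall>x\<in>topspace (S (\<tau> v)). f' (G v x) = h k v x)" for k
  proof (rule extend_from_disjoint_images[where Y = Y and V = V and f = "\<lambda>y. f y $ k" and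
        S = "\<lambda>v. S (\<tau> v)" and G = G and h = "h k" and \<delta> = "2 * \<delta>"])
    show "continuous_map Y euclideanreal (\<lambda>y. f y $ k)" using f(1) by (rule continuous_map_vec_nth)
    show "compact_space (S (\<tau> v))" if "v \<in> V" for v using T(2) V(2) that by blast
    show "0 \<le> 2 * \<delta>" using \<delta> by simp
  qed (fact Y V(1) G inj disj fk01 h_cont h01 hclose | (rule exI, intro conjI ballI; assumption | blast))+
  then have "\<forall>k. \<exists>f'. continuous_map Y euclideanreal f' \<and> (\<forall>y\<in>topspace Y. f' y \<in> {0..1}) \<and>
      (\<forall>y\<in>topspace Y. \<bar>f' y - f y $ k\<bar> \<le> 2 * \<delta>) \<and>
      (\<forall>v\<in>V. \<forall>x\<in>topspace (S (\<tau> v)). f' (G v x) = h k v x)" by (rule allI)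
  from choice[OF this] obtain g where g0: "\<forall>k. continuous_map Y euclideanreal (g k) \<and> (\<forall>y\<in>topspace Y. g k y \<in> {0..1}) \<and>
      (\<forall>y\<in>topspace Y. \<bar>g k y - f y $ k\<bar> \<le> 2 * \<delta>) \<and>
      (\<forall>v\<in>V. \<forall>x\<in>topspace (S (\<tau> v)). g k (G v x) = h k v x)" by (rule exE)
  have g: "\<And>k. continuous_map Y euclideanreal (g k)"
    "\<And>k y. y \<in> topspace Y \<Longrightarrow> g k y \<in> {0..1}"
    "\<And>k y. y \<in> topspace Y \<Longrightarrow> \<bar>g k y - f y $ k\<bar> \<le> 2 * \<delta>"
    "\<And>k v x. v \<in> V \<Longrightarrow> x \<in> topspace (S (\<tau> v)) \<Longrightarrow> g k (G v x) = h k v x"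
    using g0 by blast+
  show ?thesis
  proof (rule that[of "\<lambda>y. \<chi> k. g k y"])
    show "continuous_map Y euclidean (\<lambda>y. \<chi> k. g k y)"
      using g(1) by (rule continuous_map_vec_lambda)
    show "(\<lambda>y. \<chi> k. g k y) ` topspace Y \<subseteq> unit_cube"
      using g(2) by (auto simp: unit_cube_def)
    show "dist (f y) (\<chi> k. g k y) \<le> \<epsilon>" if y: "y \<in> topspace Y" for y
    proof -
      have "dist (f y) (\<chi> k. g k y) \<le> (\<Sum>k\<in>UNIV. \<bar>(f y - (\<chi> k. g k y)) $ k\<bar>)"
        unfolding dist_norm by (rule norm_le_l1_cart)
      also have "\<dots> \<le> (\<Sum>k\<in>(UNIV :: 'r set). 2 * \<delta>)"
        using g(3)[OF y] by (intro sum_mono) (simp add: abs_minus_commute)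
      also have "\<dots> = \<epsilon>" by (simp add: \<delta>_def)
      finally show ?thesis .
    qed
    show "\<forall>x. (\<forall>t\<in>T. x t \<in> topspace (S t)) \<longrightarrow> (\<exists>v\<in>V. \<exists>w\<in>V. R v w \<and>
        (\<chi> k. g k (G v (x (\<tau> v)))) \<noteq> (\<chi> k. g k (G w (x (\<tau> w)))))"
    proof (intro allI impI)
      fix x assume "\<forall>t\<in>T. x t \<in> topspace (S t)"
      then have x: "x t \<in> topspace (S t)" if "t \<in> T" for t using that by blast
      have "(\<Sum>W\<in>\<V> t. \<phi> t W (x t)) = 1 \<and> card {W \<in> \<V> t. \<phi> t W (x t) \<noteq> 0} \<le> d t + 1" if t: "t \<in> T" for t
      proof -
        have "{W \<in> \<V> t. \<phi> t W (x t) \<noteq> 0} = {W \<in> \<V> t. x t \<in> W}"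
          using \<phi>(2)[OF t _ x[OF t]] by blast
        then show ?thesis using \<phi>(3)[OF t x[OF t]] \<V>(5)[OF t x[OF t]] by simp
      qed
      then obtain q where q: "q \<in> Q" "(\<Sum>W\<in>\<V> (\<tau> (fst q)). \<phi> (\<tau> (fst q)) W (x (\<tau> (fst q))) * \<alpha> q W) \<noteq>
           (\<Sum>W\<in>\<V> (\<tau> (p (fst q))). \<phi> (\<tau> (p (fst q))) W (x (\<tau> (p (fst q)))) * tgt (p (fst q), snd q) W)"
        using gen[rule_format, of "\<lambda>t W. \<phi> t W (x t)"] by blast
      obtain z k where zk: "q = (z, k)" by force
      have z: "z \<in> Z" "z \<in> V" "p z \<in> V" "p z \<notin> Z" "R z (p z)" using q(1) zk Z(1) p by (auto simp: Q_def)
      have "h k z (x (\<tau> z)) \<noteq> h k (p z) (x (\<tau> (p z)))"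
        using q(2) z by (simp add: zk h_def a_def)
      then have "g k (G z (x (\<tau> z))) \<noteq> g k (G (p z) (x (\<tau> (p z))))"
        using g(4) x V(2) z by simp
      then show "\<exists>v\<in>V. \<exists>w\<in>V. R v w \<and> (\<chi> k. g k (G v (x (\<tau> v)))) \<noteq> (\<chi> k. g k (G w (x (\<tau> w))))"
        using z by (intro bexI[of _ z] bexI[of _ "p z"]) (auto simp: vec_eq_iff)
    qed
  qed
qed

section \<open>The space of maps into the cube: completeness and open conditions\<close>

lemma mspace_cube_maps:
  assumes "compact_space Y"
  shows "mspace (cube_maps Y :: ('b \<Rightarrow> real ^ 'r) metric) =
    {f. f ` topspace Y \<subseteq> unit_cube \<and> f \<in> extensional (topspace Y) \<and> continuous_map Y euclidean f}"
proof -
  have "compactin Y (topspace Y)" using assms by (simp add: compact_space_def)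
  then show ?thesis
    unfolding cube_maps_def
    by (subst compactin_mspace_cfunspace)
      (auto simp: mtopology_of_submetric continuous_map_in_subtopology)
qed

text \<open>The cube is closed in a complete space and the uniform metric inherits completeness.
  This is what admits Baire's theorem.\<close>

lemma completely_metrizable_cube_maps:
  "completely_metrizable_space (mtopology_of (cube_maps Y :: ('b \<Rightarrow> real ^ 'r) metric))"
proof -
  have "closed (unit_cube :: (real ^ 'r) set)"
    unfolding unit_cube_def by (intro closed_Collect_all closed_Collect_conj closed_Collect_le continuous_intros)
  interpret U: Submetric UNIV dist "unit_cube :: (real ^ 'r) set"
    by unfold_locales auto
  have "U.sub.mcomplete"
    using \<open>closed unit_cube\<close> complete_UNIV by (intro U.closedin_mcomplete_imp_mcomplete) auto
  then have "mcomplete_of (cfunspace Y U.sub.Self)" by (rule U.sub.mcomplete_cfunspace)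
  moreover have "U.sub.Self = submetric euclidean_metric unit_cube"
    by (simp add: U.sub.Self_def submetric_def)
  ultimately have "mcomplete_of (cube_maps Y :: ('b \<Rightarrow> real ^ 'r) metric)" by (simp add: cube_maps_def)
  then show ?thesis
    unfolding mcomplete_of_def mtopology_of_def
    by (rule Metric_space.completely_metrizable_space_mtopology[OF Metric_space_mspace_mdist])
qed

text \<open>The total separation \<open>D\<close> is continuous and positive on the compact set
  \<open>K\<close>, hence bounded below by a positive minimum, which a uniformly small change of
  \<open>f\<close> cannot cancel.\<close>

lemma openin_separating_maps:
  fixes g :: "nat \<Rightarrow> 'a \<Rightarrow> 'b" and Y :: "'b topology"
  assumes Y: "compact_space Y" and g: "\<And>i. i \<in> {1..N} \<Longrightarrow> continuous_map X Y (g i)"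
    and K: "compactin (prod_topology X X) K"
  shows "openin (mtopology_of (cube_maps Y :: ('b \<Rightarrow> real ^ 'r) metric))
    {f \<in> mspace (cube_maps Y). \<forall>(x, y)\<in>K. \<exists>i\<in>{1..N}. f (g i x) \<noteq> f (g i y)}" (is "openin _ ?U")
proof -
  let ?m = "cube_maps Y :: ('b \<Rightarrow> real ^ 'r) metric"
  interpret M: Metric_space "mspace ?m" "mdist ?m" by (rule Metric_space_mspace_mdist)
  have KX: "K \<subseteq> topspace X \<times> topspace X" using compactin_subset_topspace[OF K] by simp
  have gY: "g i x \<in> topspace Y" if "i \<in> {1..N}" "x \<in> topspace X" for i x
    using g[OF that(1)] that(2) by (meson continuous_map_image_subset_topspace image_subset_iff)
  have "\<exists>r>0. M.mball f r \<subseteq> ?U" if f: "f \<in> ?U" for f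
  proof (cases "K = {}")
    case True
    then have "M.mball f 1 \<subseteq> ?U" by (auto simp: M.in_mball)
    then show ?thesis by (intro exI[of _ 1]) simp
  next
    case False
    have fm: "f \<in> mspace ?m" using f by blast
    then have fc: "continuous_map Y euclidean f" by (simp add: mspace_cube_maps[OF Y])
    define D where "D z = (\<Sum>i\<in>{1..N}. norm (f (g i (fst z)) - f (g i (snd z))))" for z
    have "continuous_map (prod_topology X X) euclideanreal D"
      unfolding D_def
    proof (intro continuous_map_sum continuous_map_norm continuous_map_diff)
      fix i assume i: "i \<in> {1..N}"
      have fg: "continuous_map X euclidean (\<lambda>x. f (g i x))"
        using continuous_map_compose[OF g[OF i] fc] by (simp add: o_def)
      show "continuous_map (prod_topology X X) euclidean (\<lambda>z. f (g i (fst z)))"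
        using continuous_map_compose[OF continuous_map_fst fg] by (simp add: o_def)
      show "continuous_map (prod_topology X X) euclidean (\<lambda>z. f (g i (snd z)))"
        using continuous_map_compose[OF continuous_map_snd fg] by (simp add: o_def)
    qed simp
    then have "compactin euclideanreal (D ` K)" using K by (rule image_compactin[rotated])
    then have "compact (D ` K)" by simp
    then obtain z0 where z0: "z0 \<in> K" "\<And>z. z \<in> K \<Longrightarrow> D z0 \<le> D z"
      using compact_attains_inf[of "D ` K"] False by auto
    have "\<forall>(x, y)\<in>K. \<exists>i\<in>{1..N}. f (g i x) \<noteq> f (g i y)" using f by blast
    then obtain i where i: "i \<in> {1..N}" "f (g i (fst z0)) \<noteq> f (g i (snd z0))"
      using z0(1) by (cases z0) auto
    then have pos: "D z0 > 0" unfolding D_def by (intro sum_pos2[of _ i]) auto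
    define r where "r = D z0 / (2 * real N + 1)"
    have r: "r > 0" using pos by (simp add: r_def)
    have "f' \<in> ?U" if f': "f' \<in> M.mball f r" for f'
    proof -
      have fm': "f' \<in> mspace ?m" and dist: "mdist ?m f f' \<le> r" using f' by (auto simp: M.in_mball)
      have d: "dist (f y) (f' y) \<le> r" if "y \<in> topspace Y" for y
        using mdist_cfunspace_imp_mdist_le[OF fm[unfolded cube_maps_def] fm'[unfolded cube_maps_def]
            dist[unfolded cube_maps_def] that] by simp
      have "\<exists>i\<in>{1..N}. f' (g i x) \<noteq> f' (g i y)" if xy: "(x, y) \<in> K" for x y
      proof (rule ccontr)
        assume no: "\<not> (\<exists>i\<in>{1..N}. f' (g i x) \<noteq> f' (g i y))"
        have XY: "x \<in> topspace X" "y \<in> topspace X" using KX xy by auto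
        have "norm (f (g i x) - f (g i y)) \<le> 2 * r" if i: "i \<in> {1..N}" for i
        proof -
          have "f' (g i x) = f' (g i y)" using no i by blast
          then have "dist (f (g i x)) (f (g i y)) \<le> dist (f (g i x)) (f' (g i x)) + dist (f (g i y)) (f' (g i y))"
            by (metis dist_triangle2)
          then show ?thesis using d[OF gY[OF i XY(1)]] d[OF gY[OF i XY(2)]] by (simp add: dist_norm)
        qed
        then have "D (x, y) \<le> (\<Sum>i\<in>{1..N}. 2 * r)" unfolding D_def by (intro sum_mono) simp
        also have "\<dots> < (2 * real N + 1) * r" using r by (simp add: algebra_simps)
        also have "\<dots> = D z0" by (simp add: r_def)
        finally show False using z0(2)[OF xy] by simp
      qed
      then show ?thesis using fm' by blast
    qed
    then have "M.mball f r \<subseteq> ?U" by (rule subsetI)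
    then show ?thesis using r by (intro exI[of _ r] conjI)
  qed
  then show ?thesis unfolding mtopology_of_def M.openin_mtopology by blast
qed

section \<open>Dimension bounds from coincidence patterns\<close>

text \<open>Translates between a labelling \<open>k\<close> of the indices, the form in which
  patterns occur, and the partitions and blocks of the hypothesis.\<close>

lemma fibre_partition:
  fixes k :: "'i \<Rightarrow> 'k" and A :: "'i set"
  defines "P \<equiv> (\<lambda>i. {j \<in> A. k j = k i}) ` A"
  shows "partition_on A P" "\<And>i. i \<in> A \<Longrightarrow> block P i = {j \<in> A. k j = k i}" "card P = card (k ` A)"
proof -
  show "partition_on A P"
    unfolding partition_on_def disjoint_def P_def by auto
  show "block P i = {j \<in> A. k j = k i}" if "i \<in> A" for i
    unfolding block_def P_def by (rule the_equality) (use that in auto)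
  have "P = (\<lambda>c. {j \<in> A. k j = c}) ` (k ` A)" by (auto simp: P_def)
  moreover have "inj_on (\<lambda>c. {j \<in> A. k j = c}) (k ` A)" by (auto simp: inj_on_def)
  ultimately show "card P = card (k ` A)" by (simp add: card_image)
qed

text \<open>The pattern is exact on \<open>K\<close>, so \<open>K\<close> lies in a single
  coincidence set. It is closed there, even if that set is not closed in \<open>X\<close>, and this
  suffices for the dimension bound to pass to \<open>K\<close>.\<close>

lemma covering_dim_of_pattern:
  fixes g :: "nat \<Rightarrow> 'a \<Rightarrow> 'b" and k :: "nat \<Rightarrow> 'k"
  assumes dim: "\<And>P. partition_on {1..N} P \<Longrightarrow>
      ereal_of_enat (covering_dim (subtopology X (coincidence_set X N g P)))
        < ereal (real R / 2 * real (card P))"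
    and K: "closedin X K"
    and pat: "\<And>x i j. x \<in> K \<Longrightarrow> i \<in> {1..N} \<Longrightarrow> j \<in> {1..N} \<Longrightarrow> g i x = g j x \<longleftrightarrow> k i = k j"
  obtains d where "covering_dim_le (subtopology X K) d" "2 * d < R * card (k ` {1..N})"
proof -
  define P where "P = (\<lambda>i. {j \<in> {1..N}. k j = k i}) ` {1..N}"
  note P = fibre_partition[where A = "{1..N}" and k = k, folded P_def]
  let ?Q = "coincidence_set X N g P"
  have "block P i = block P j \<longleftrightarrow> k i = k j" if "i \<in> {1..N}" "j \<in> {1..N}" for i j
    unfolding P(2)[OF that(1)] P(2)[OF that(2)]
  proof
    assume "{l \<in> {1..N}. k l = k i} = {l \<in> {1..N}. k l = k j}"
    moreover have "i \<in> {l \<in> {1..N}. k l = k i}" using that(1) by simp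
    ultimately have "i \<in> {l \<in> {1..N}. k l = k j}" by (simp only:)
    then show "k i = k j" by simp
  qed simp
  then have KQ: "K \<subseteq> ?Q"
    using closedin_subset[OF K] pat by (auto simp: coincidence_set_def)
  obtain d where d: "covering_dim_le (subtopology X ?Q) d" "real d < real R / 2 * real (card P)"
    using dim[OF P(1)] by (rule covering_dim_attained)
  have "closedin (subtopology X ?Q) K" using K KQ by (rule closedin_subset_topspace)
  with d(1) have "covering_dim_le (subtopology (subtopology X ?Q) K) d"
    by (rule covering_dim_le_closedin)
  moreover have "subtopology (subtopology X ?Q) K = subtopology X K"
    using KQ by (simp add: subtopology_subtopology Int_absorb1)
  moreover have "2 * d < R * card (k ` {1..N})"
  proof -
    have "real (2 * d) < real (R * card P)" using d(2) by simp
    then show ?thesis unfolding of_nat_less_iff P(3) .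
  qed
  ultimately show ?thesis using that by simp
qed

section \<open>Countably many compact sets of pairs with fixed pattern\<close>

text \<open>Closed balls of radius \<open>1 / (n + 1)\<close> around finite nets. Closedness of the
  members is what later makes the sets of pairs compact.\<close>

lemma countable_closed_neighbourhood_base:
  assumes "compact_space X" "metrizable_space X"
  obtains \<B> where "countable \<B>" "\<And>B. B \<in> \<B> \<Longrightarrow> closedin X B"
    "\<And>U x. openin X U \<Longrightarrow> x \<in> U \<Longrightarrow> \<exists>B\<in>\<B>. x \<in> B \<and> B \<subseteq> U"
proof -
  obtain M d where Md: "Metric_space M d" "X = Metric_space.mtopology M d"
    using assms(2) metrizable_space_def by blast
  interpret Metric_space M d by (rule Md(1))
  have X: "X = mtopology" by (rule Md(2))
  define \<delta> where "\<delta> n = 1 / (real n + 1)" for n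
  have "\<exists>F. finite F \<and> F \<subseteq> M \<and> M \<subseteq> (\<Union>c\<in>F. mball c (\<delta> n))" for n
  proof -
    have "\<exists>\<F>. finite \<F> \<and> \<F> \<subseteq> (\<lambda>c. mball c (\<delta> n)) ` M \<and> topspace X \<subseteq> \<Union>\<F>"
      using assms(1)[unfolded compact_space_alt, rule_format, of "(\<lambda>c. mball c (\<delta> n)) ` M"]
      by (force simp: X \<delta>_def)
    then obtain \<F> where \<F>: "finite \<F>" "\<F> \<subseteq> (\<lambda>c. mball c (\<delta> n)) ` M" "topspace X \<subseteq> \<Union>\<F>" by blast
    obtain F where "F \<subseteq> M" "finite F" "\<F> = (\<lambda>c. mball c (\<delta> n)) ` F"
      using finite_subset_image[OF \<F>(1,2)] by blast
    then show ?thesis using \<F>(3) by (intro exI[of _ F]) (simp add: X)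
  qed
  then have "\<forall>n. \<exists>F. finite F \<and> F \<subseteq> M \<and> M \<subseteq> (\<Union>c\<in>F. mball c (\<delta> n))" by blast
  from choice[OF this] obtain F where F: "\<forall>n. finite (F n) \<and> F n \<subseteq> M \<and> M \<subseteq> (\<Union>c\<in>F n. mball c (\<delta> n))"
    by (rule exE)
  define \<B> where "\<B> = (\<Union>n. (\<lambda>c. mcball c (\<delta> n)) ` F n)"
  show ?thesis
  proof (rule that[of \<B>])
    show "countable \<B>" unfolding \<B>_def using F by (intro countable_UN) (auto intro: countable_finite)
    show "closedin X B" if "B \<in> \<B>" for B using that by (auto simp: \<B>_def X)
    fix U x assume U: "openin X U" "x \<in> U"
    then obtain r where r: "r > 0" "mball x r \<subseteq> U" and x: "x \<in> M"
      by (metis X openin_mtopology subsetD)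
    obtain n where n: "\<delta> n < r / 2"
      using reals_Archimedean[of "r / 2"] r(1) by (auto simp: \<delta>_def inverse_eq_divide add.commute)
    obtain c where c: "c \<in> F n" "x \<in> mball c (\<delta> n)" using F x by blast
    have "mcball c (\<delta> n) \<subseteq> mball x r"
    proof
      fix y assume "y \<in> mcball c (\<delta> n)"
      then have y: "y \<in> M" "d c y \<le> \<delta> n" and cx: "c \<in> M" "d c x < \<delta> n" using c by auto
      have "d x y \<le> d x c + d c y" using x cx y triangle by blast
      then show "y \<in> mball x r" using x y cx n by (simp add: commute[of x c])
    qed
    moreover have "x \<in> mcball c (\<delta> n)" using c by auto
    ultimately show "\<exists>B\<in>\<B>. x \<in> B \<and> B \<subseteq> U" using c(1) r(2) unfolding \<B>_def by blast
  qed
qed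

lemma Hausdorff_finite_separation:
  assumes "Hausdorff_space Y" "finite F" "F \<subseteq> topspace Y"
  obtains W where "\<And>a. a \<in> F \<Longrightarrow> openin Y (W a)" "\<And>a. a \<in> F \<Longrightarrow> a \<in> W a"
    "\<And>a b. a \<in> F \<Longrightarrow> b \<in> F \<Longrightarrow> a \<noteq> b \<Longrightarrow> W a \<inter> W b = {}"
proof -
  have "\<exists>U V. openin Y U \<and> openin Y V \<and> a \<in> U \<and> b \<in> V \<and> U \<inter> V = {}"
    if "a \<in> F" "b \<in> F" "a \<noteq> b" for a b
    using assms(1,3) that unfolding Hausdorff_space_def disjnt_def by blast
  then obtain U V where UV: "\<And>a b. a \<in> F \<Longrightarrow> b \<in> F \<Longrightarrow> a \<noteq> b \<Longrightarrow>
      openin Y (U a b) \<and> openin Y (V a b) \<and> a \<in> U a b \<and> b \<in> V a b \<and> U a b \<inter> V a b = {}" by metis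
  \<comment> \<open>Each pair of points is separated in both orders, as the choice of
    \<open>U\<close> and \<open>V\<close> need not be symmetric.\<close>
  define W where "W a = topspace Y \<inter> (\<Inter>b\<in>F - {a}. U a b \<inter> V b a)" for a
  show ?thesis
  proof (rule that[of W])
    show "openin Y (W a)" if "a \<in> F" for a
    proof (cases "F - {a} = {}")
      case True
      then show ?thesis by (simp only: W_def True) simp
    next
      case False
      then show ?thesis unfolding W_def
        using UV that assms(2) by (intro openin_Int openin_INT2) auto
    qed
    show "a \<in> W a" if "a \<in> F" for a using UV that assms(3) unfolding W_def by blast
    show "W a \<inter> W b = {}" if "a \<in> F" "b \<in> F" "a \<noteq> b" for a b
    proof -
      have "W a \<subseteq> U a b" "W b \<subseteq> V a b" using that unfolding W_def by blast+
      then show ?thesis using UV[OF that] by blast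
    qed
  qed
qed

text \<open>The index \<open>(i, s)\<close> stands for the point \<open>g i x\<close> if \<open>s\<close> is false and for \<open>g i y\<close> if it is true.
  A pattern \<open>\<rho>\<close> sends each index to a representative of its class of coinciding points.\<close>
definition pair_indices :: "nat \<Rightarrow> (nat \<times> bool) set" where
  "pair_indices N = {1..N} \<times> UNIV"

definition pair_value :: "(nat \<Rightarrow> 'a \<Rightarrow> 'b) \<Rightarrow> nat \<times> bool \<Rightarrow> 'a \<times> 'a \<Rightarrow> 'b" where
  "pair_value g p z = g (fst p) (if snd p then snd z else fst z)"

text \<open>Only equalities are imposed, which keeps the set closed in the box; the inequalities are
  demanded of the whole box by \<open>separated_pattern\<close>.\<close>

definition pattern_pairs :: "nat \<Rightarrow> (nat \<Rightarrow> 'a \<Rightarrow> 'b) \<Rightarrow> 'a set \<Rightarrow> 'a set \<Rightarrow>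
    (nat \<times> bool \<Rightarrow> nat \<times> bool) \<Rightarrow> ('a \<times> 'a) set" where
  "pattern_pairs N g A B \<rho> = {z \<in> A \<times> B. \<forall>p\<in>pair_indices N. \<forall>q\<in>pair_indices N.
     \<rho> p = \<rho> q \<longrightarrow> pair_value g p z = pair_value g q z}"

text \<open>In the last clause \<open>z\<close> and \<open>z'\<close> vary independently: the whole
  images of different classes are disjoint, as needed for prescribing values on them. Idempotence
  makes every representative represent itself, and
  \<open>\<rho> (i, False) \<noteq> \<rho> (i, True)\<close> excludes loops from the graph.\<close>

definition separated_pattern :: "nat \<Rightarrow> (nat \<Rightarrow> 'a \<Rightarrow> 'b) \<Rightarrow> 'a set \<Rightarrow> 'a set \<Rightarrow>
    (nat \<times> bool \<Rightarrow> nat \<times> bool) \<Rightarrow> bool" where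
  "separated_pattern N g A B \<rho> \<longleftrightarrow>
     \<rho> ` pair_indices N \<subseteq> pair_indices N \<and>
     (\<forall>p\<in>pair_indices N. \<rho> (\<rho> p) = \<rho> p) \<and>
     (\<forall>i\<in>{1..N}. \<rho> (i, False) \<noteq> \<rho> (i, True)) \<and>
     (\<forall>p\<in>pair_indices N. \<forall>q\<in>pair_indices N. \<rho> p \<noteq> \<rho> q \<longrightarrow>
        (\<forall>z\<in>A \<times> B. \<forall>z'\<in>A \<times> B. pair_value g p z \<noteq> pair_value g q z'))"

lemma continuous_map_pair_value:
  assumes "continuous_map X Y (g (fst p))"
  shows "continuous_map (prod_topology X X) Y (pair_value g p)"
proof (cases "snd p")
  case True
  then have "pair_value g p = g (fst p) \<circ> snd" by (simp add: pair_value_def fun_eq_iff)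
  then show ?thesis using continuous_map_compose[OF continuous_map_snd assms] by simp
next
  case False
  then have "pair_value g p = g (fst p) \<circ> fst" by (simp add: pair_value_def fun_eq_iff)
  then show ?thesis using continuous_map_compose[OF continuous_map_fst assms] by simp
qed

lemma compactin_pattern_pairs:
  assumes "compact_space X" "Hausdorff_space Y"
    and g: "\<And>i. i \<in> {1..N} \<Longrightarrow> continuous_map X Y (g i)"
    and "closedin X A" "closedin X B"
  shows "compactin (prod_topology X X) (pattern_pairs N g A B \<rho>)"
proof -
  let ?I = "{(p, q) \<in> pair_indices N \<times> pair_indices N. \<rho> p = \<rho> q}"
  let ?E = "\<lambda>(p, q). {z \<in> topspace (prod_topology X X). pair_value g p z = pair_value g q z}"
  have sub: "A \<times> B \<subseteq> topspace (prod_topology X X)"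
    using assms(4,5)[THEN closedin_subset] by auto
  have "closedin (prod_topology X X) (?E pq)" if "pq \<in> ?I" for pq
  proof -
    obtain p q where pq: "pq = (p, q)" by (cases pq)
    then have "fst p \<in> {1..N}" "fst q \<in> {1..N}" using that by (auto simp: pair_indices_def)
    then show ?thesis unfolding pq prod.case
      using g assms(2) by (intro closedin_continuous_maps_eq continuous_map_pair_value) auto
  qed
  then have "closedin (prod_topology X X) (\<Inter> (insert (A \<times> B) (?E ` ?I)))"
    using assms(4,5) by (intro closedin_Inter) (auto simp: closedin_prod_Times_iff)
  moreover have "\<Inter> (insert (A \<times> B) (?E ` ?I)) = pattern_pairs N g A B \<rho>"
  proof (intro equalityI subsetI)
    fix z assume z: "z \<in> \<Inter> (insert (A \<times> B) (?E ` ?I))"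
    have "pair_value g p z = pair_value g q z"
      if "p \<in> pair_indices N" "q \<in> pair_indices N" "\<rho> p = \<rho> q" for p q
    proof -
      have "?E (p, q) \<in> ?E ` ?I" using that by (intro imageI) simp
      then have "z \<in> ?E (p, q)" using z by blast
      then show ?thesis by simp
    qed
    then show "z \<in> pattern_pairs N g A B \<rho>" using z unfolding pattern_pairs_def by blast
  next
    fix z assume "z \<in> pattern_pairs N g A B \<rho>"
    then show "z \<in> \<Inter> (insert (A \<times> B) (?E ` ?I))" using sub by (auto simp: pattern_pairs_def)
  qed
  ultimately have "closedin (prod_topology X X) (pattern_pairs N g A B \<rho>)" by (simp only:)
  moreover have "compact_space (prod_topology X X)"
    using assms(1) by (simp add: compact_space_prod_topology)
  ultimately show ?thesis by (intro closedin_compact_space)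
qed

text \<open>Take disjoint neighbourhoods of the finitely many values at \<open>(x, y)\<close>; by
  continuity, small \<open>A\<close> and \<open>B\<close> keep every point inside the neighbourhood
  of its value. Injectivity of \<open>g i\<close> separates \<open>(i, False)\<close> from
  \<open>(i, True)\<close>.\<close>

lemma separated_pattern_exists:
  fixes g :: "nat \<Rightarrow> 'a \<Rightarrow> 'b"
  assumes "Hausdorff_space Y"
    and g: "\<And>i. i \<in> {1..N} \<Longrightarrow> continuous_map X Y (g i)"
    and inj: "\<And>i. i \<in> {1..N} \<Longrightarrow> inj_on (g i) (topspace X)"
    and base: "\<And>U x. openin X U \<Longrightarrow> x \<in> U \<Longrightarrow> \<exists>B\<in>\<B>. x \<in> B \<and> B \<subseteq> U"
    and xy: "x \<in> topspace X" "y \<in> topspace X" "x \<noteq> y"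
  obtains A B \<rho> where "A \<in> \<B>" "B \<in> \<B>" "\<rho> \<in> pair_indices N \<rightarrow>\<^sub>E pair_indices N"
    "separated_pattern N g A B \<rho>" "(x, y) \<in> pattern_pairs N g A B \<rho>"
proof -
  let ?I = "pair_indices N"
  define H where "H p = pair_value g p (x, y)" for p
  have HY: "H ` ?I \<subseteq> topspace Y"
  proof
    fix b assume "b \<in> H ` ?I"
    then obtain p where p: "fst p \<in> {1..N}" "b = H p" by (auto simp: pair_indices_def)
    then show "b \<in> topspace Y"
      using g[OF p(1)] xy by (auto simp: H_def pair_value_def continuous_map_def)
  qed
  have "finite (H ` ?I)" by (simp add: pair_indices_def)
  then obtain W where W: "\<And>a. a \<in> H ` ?I \<Longrightarrow> openin Y (W a)" "\<And>a. a \<in> H ` ?I \<Longrightarrow> a \<in> W a"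
    "\<And>a b. a \<in> H ` ?I \<Longrightarrow> b \<in> H ` ?I \<Longrightarrow> a \<noteq> b \<Longrightarrow> W a \<inter> W b = {}"
    using Hausdorff_finite_separation[OF assms(1) _ HY] by blast
  define U where "U s = topspace X \<inter> (\<Inter>i\<in>{1..N}. {x \<in> topspace X. g i x \<in> W (H (i, s))})" for s
  have opU: "openin X (U s)" for s
  proof (cases "{1..N} = {}")
    case False
    have "openin X {x \<in> topspace X. g i x \<in> W (H (i, s))}" if "i \<in> {1..N}" for i
      using g[OF that] by (rule openin_continuous_map_preimage) (use W(1) that in \<open>simp add: pair_indices_def\<close>)
    then show ?thesis unfolding U_def using False by (intro openin_Int openin_INT2) auto
  qed (simp add: U_def)
  have HW: "H (i, s) \<in> W (H (i, s))" if "i \<in> {1..N}" for i s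
    using that by (intro W(2) imageI) (simp add: pair_indices_def)
  have "H (i, False) = g i x" "H (i, True) = g i y" for i by (simp_all add: H_def pair_value_def)
  then have "g i x \<in> W (H (i, False))" "g i y \<in> W (H (i, True))" if "i \<in> {1..N}" for i
    using HW[OF that, of False] HW[OF that, of True] by simp_all
  then have "x \<in> U False" "y \<in> U True" using xy by (auto simp: U_def)
  then obtain A B where A: "A \<in> \<B>" "x \<in> A" "A \<subseteq> U False" and B: "B \<in> \<B>" "y \<in> B" "B \<subseteq> U True"
    using base[OF opU] by meson
  \<comment> \<open>One index is chosen per value, so coinciding indices get the same
    representative. The restriction places \<rho> in a finite set of functions, which countability
    needs.\<close>
  define \<rho> where "\<rho> = restrict (\<lambda>p. inv_into ?I H (H p)) ?I"
  have \<rho>I: "\<rho> p \<in> ?I" and H\<rho>: "H (\<rho> p) = H p" if "p \<in> ?I" for p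
    using that by (auto simp: \<rho>_def inv_into_into f_inv_into_f)
  have \<rho>_eq: "\<rho> p = \<rho> q \<longleftrightarrow> H p = H q" if "p \<in> ?I" "q \<in> ?I" for p q
    using that H\<rho> by (metis \<rho>_def restrict_apply')
  have val: "pair_value g p z \<in> W (H p)" if "p \<in> ?I" "z \<in> A \<times> B" for p z
  proof -
    obtain i s where p: "p = (i, s)" by force
    have i: "i \<in> {1..N}" using that(1) p by (auto simp: pair_indices_def)
    have "(if s then snd z else fst z) \<in> U s" using that(2) A(3) B(3) by (cases s) auto
    then show ?thesis using i by (simp add: p U_def pair_value_def)
  qed
  show ?thesis
  proof (rule that[OF A(1) B(1), of \<rho>])
    show "\<rho> \<in> ?I \<rightarrow>\<^sub>E ?I" using \<rho>I by (auto simp: \<rho>_def)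
    show "(x, y) \<in> pattern_pairs N g A B \<rho>"
      using A(2) B(2) \<rho>_eq by (auto simp: pattern_pairs_def H_def)
    have "\<rho> (i, False) \<noteq> \<rho> (i, True)" if "i \<in> {1..N}" for i
      using \<rho>_eq[of "(i, False)" "(i, True)"] that inj[OF that] xy
      by (simp add: pair_indices_def H_def pair_value_def inj_on_eq_iff)
    moreover have "pair_value g p z \<noteq> pair_value g q z'"
      if "p \<in> ?I" "q \<in> ?I" "\<rho> p \<noteq> \<rho> q" "z \<in> A \<times> B" "z' \<in> A \<times> B" for p q z z'
    proof -
      have "W (H p) \<inter> W (H q) = {}" using W(3) \<rho>_eq that(1-3) by blast
      then show ?thesis using val that by (metis disjoint_iff)
    qed
    moreover have "\<rho> (\<rho> p) = \<rho> p" if "p \<in> ?I" for p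
      using \<rho>_eq[OF \<rho>I[OF that] that] H\<rho>[OF that] by simp
    ultimately show "separated_pattern N g A B \<rho>"
      unfolding separated_pattern_def using \<rho>I by blast
  qed
qed

text \<open>On the diagonal the two copies of index 1 would coincide, although the pattern separates
  them. Hence an injective tuple map meets every one of the countably many conditions.\<close>

lemma separated_pattern_imp_neq:
  assumes "separated_pattern N g A B \<rho>" "N \<ge> 1" "(x, y) \<in> pattern_pairs N g A B \<rho>"
  shows "x \<noteq> y"
proof
  assume "x = y"
  have "1 \<in> {1..N}" using assms(2) by simp
  then have "\<rho> (1, False) \<noteq> \<rho> (1, True)" using assms(1) unfolding separated_pattern_def by blast
  moreover have "(1, False) \<in> pair_indices N" "(1, True) \<in> pair_indices N"
    using assms(2) by (simp_all add: pair_indices_def)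
  moreover have "(x, y) \<in> A \<times> B" using assms(3) by (simp add: pattern_pairs_def)
  ultimately have "pair_value g (1, False) (x, y) \<noteq> pair_value g (1, True) (x, y)"
    using assms(1) unfolding separated_pattern_def by blast
  then show False using \<open>x = y\<close> by (simp add: pair_value_def)
qed

section \<open>Density for a single pattern and passage to the countable intersection\<close>

theorem theorem1p5:
  fixes X :: "'a topology" and Y :: "'b topology"
    and N :: nat and g :: "nat \<Rightarrow> 'a \<Rightarrow> 'b"
  assumes "compact_space X" and "metrizable_space X"
    and "compact_space Y" and "metrizable_space Y"
    and "N \<ge> 1"
    and "\<And>i. i \<in> {1..N} \<Longrightarrow> continuous_map X Y (g i)"
    and "\<And>i. i \<in> {1..N} \<Longrightarrow> inj_on (g i) (topspace X)"
    and "\<And>P. partition_on {1..N} P \<Longrightarrow>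
           ereal_of_enat (covering_dim (subtopology X (coincidence_set X N g P)))
             < ereal (real CARD('r::finite) / 2 * real (card P))"
  defines "C \<equiv> mtopology_of (cube_maps Y :: ('b \<Rightarrow> real ^ 'r) metric)"
    and "S \<equiv> {f \<in> mspace (cube_maps Y :: ('b \<Rightarrow> real ^ 'r) metric).
              inj_on (tuple_map N g f) (topspace X)}"
  shows "gdelta_in C S \<and> C closure_of S = topspace C"
proof -
  note X = assms(1,2) and Y = assms(3,4) and N = assms(5) and g = assms(6) and inj = assms(7) and dim = assms(8)
  let ?m = "cube_maps Y :: ('b \<Rightarrow> real ^ 'r) metric"
  have dense: "\<exists>f' \<in> mspace ?m. mdist ?m f f' \<le> \<epsilon> \<and>
     (\<forall>(x, y)\<in>pattern_pairs N g A B \<rho>. \<exists>i\<in>{1..N}. f' (g i x) \<noteq> f' (g i y))"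
    if cl: "closedin X A" "closedin X B" and sep: "separated_pattern N g A B \<rho>"
      and f: "f \<in> mspace ?m" and "\<epsilon> > 0" for A B \<rho> f \<epsilon>
  proof -
    define I where "I = pair_indices N"
    define K where "K = pattern_pairs N g A B \<rho>"
    have T2X: "Hausdorff_space X" and T2Y: "Hausdorff_space Y"
      using X Y metrizable_imp_Hausdorff_space by blast+
    have normY: "normal_space Y" using Y(2) by (rule metrizable_imp_normal_space)
    have finI: "finite I" by (simp add: I_def pair_indices_def)
    have I: "p \<in> I \<longleftrightarrow> fst p \<in> {1..N}" for p by (cases p) (simp add: I_def pair_indices_def)
    have \<rho>I: "\<rho> p \<in> I" and \<rho>\<rho>: "\<rho> (\<rho> p) = \<rho> p" if "p \<in> I" for p
      using sep that unfolding separated_pattern_def I_def by blast+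
    have \<rho>FT: "\<rho> (i, False) \<noteq> \<rho> (i, True)" if "i \<in> {1..N}" for i
      using sep that unfolding separated_pattern_def by blast
    have apart: "pair_value g p z \<noteq> pair_value g q z'"
      if "p \<in> I" "q \<in> I" "\<rho> p \<noteq> \<rho> q" "z \<in> K" "z' \<in> K" for p q z z'
      using sep that unfolding separated_pattern_def I_def K_def pattern_pairs_def by blast
    have coin: "pair_value g p z = pair_value g q z"
      if "p \<in> I" "q \<in> I" "\<rho> p = \<rho> q" "z \<in> K" for p q z
      using that unfolding I_def K_def pattern_pairs_def by blast
    have val_\<rho>: "pair_value g (\<rho> p) z = pair_value g p z" if "p \<in> I" "z \<in> K" for p z
      using coin[of "\<rho> p" p z] \<rho>I \<rho>\<rho> that by blast
    have Kcomp: "compactin (prod_topology X X) K"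
      unfolding K_def using X(1) T2Y g cl by (rule compactin_pattern_pairs)
    have KX: "fst z \<in> topspace X" "snd z \<in> topspace X" if "z \<in> K" for z
      using compactin_subset_topspace[OF Kcomp] that by auto
    have comp1: "compactin X (fst ` K)" and comp2: "compactin X (snd ` K)"
      using Kcomp by (rule image_compactin, intro continuous_map_fst continuous_map_snd)+
    have cl1: "closedin X (fst ` K)" and cl2: "closedin X (snd ` K)"
      using comp1 comp2 T2X by (simp_all add: compactin_imp_closedin)
    \<comment> \<open>Equal labels give equal values on \<open>K\<close>, and different labels give
      different values on the whole box. Hence the projections of \<open>K\<close> have exact
      patterns, while on \<open>A\<close> and \<open>B\<close> themselves the equalities may
      fail.\<close>
    have pat: "g i x = g j x \<longleftrightarrow> \<rho> (i, s) = \<rho> (j, s)"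
      if "x \<in> (if s then snd else fst) ` K" "i \<in> {1..N}" "j \<in> {1..N}" for x i j s
    proof -
      from that(1) obtain z where z: "z \<in> K" "x = (if s then snd z else fst z)" by (cases s) auto
      have "g i x = pair_value g (i, s) z" "g j x = pair_value g (j, s) z"
        by (simp_all add: pair_value_def z(2))
      then show ?thesis using coin[of "(i, s)" "(j, s)" z] apart[of "(i, s)" "(j, s)" z z] z(1) that(2,3) I by auto
    qed
    obtain d1 where d1: "covering_dim_le (subtopology X (fst ` K)) d1"
      "2 * d1 < CARD('r) * card ((\<lambda>i. \<rho> (i, False)) ` {1..N})"
      using covering_dim_of_pattern[OF dim cl1, of "\<lambda>i. \<rho> (i, False)"] pat[of _ False] by auto
    obtain d2 where d2: "covering_dim_le (subtopology X (snd ` K)) d2"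
      "2 * d2 < CARD('r) * card ((\<lambda>i. \<rho> (i, True)) ` {1..N})"
      using covering_dim_of_pattern[OF dim cl2, of "\<lambda>i. \<rho> (i, True)"] pat[of _ True] by auto
    \<comment> \<open>Vertices are representatives, so coinciding points count once; each
      \<open>i\<close> contributes an edge of \<open>R\<close>.\<close>
    define V where "V = \<rho> ` I"
    have finV: "finite V" using finI by (simp add: V_def)
    have VI: "v \<in> I" "\<rho> v = v" if "v \<in> V" for v using that \<rho>I \<rho>\<rho> by (auto simp: V_def)
    have Vg: "fst v \<in> {1..N}" if "v \<in> V" for v using VI(1)[OF that] I by blast
    have V_split: "V = (\<lambda>i. \<rho> (i, False)) ` {1..N} \<union> (\<lambda>i. \<rho> (i, True)) ` {1..N}"
    proof -
      have "I = (\<lambda>i. (i, False)) ` {1..N} \<union> (\<lambda>i. (i, True)) ` {1..N}"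
        by (auto simp: I_def pair_indices_def image_iff)
      then show ?thesis by (simp add: V_def image_Un image_image)
    qed
    define R where "R v w \<longleftrightarrow> (\<exists>i\<in>{1..N}. \<exists>s. v = \<rho> (i, s) \<and> w = \<rho> (i, \<not> s))" for v w
    have Rsym: "R w v" if "R v w" for v w
    proof -
      obtain i s where "i \<in> {1..N}" "v = \<rho> (i, s)" "w = \<rho> (i, \<not> s)" using \<open>R v w\<close> R_def by blast
      then show ?thesis unfolding R_def by (intro bexI[of _ i] exI[of _ "\<not> s"]) auto
    qed
    have Rnbr: "\<exists>w\<in>V. w \<noteq> v \<and> R v w" if v: "v \<in> V" for v
    proof -
      obtain i s where iss: "i \<in> {1..N}" "v = \<rho> (i, s)" using v by (auto simp: V_def I_def pair_indices_def)
      have "\<rho> (i, \<not> s) \<in> V" using iss I by (simp add: V_def)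
      moreover have "\<rho> (i, \<not> s) \<noteq> v" using \<rho>FT[OF iss(1)] iss(2) by (cases s) auto
      ultimately show ?thesis using iss unfolding R_def by blast
    qed
    have fY: "continuous_map Y euclidean f" "f ` topspace Y \<subseteq> unit_cube"
      using f by (auto simp: mspace_cube_maps[OF Y(1)])
    have sub_fst: "topspace (subtopology X (fst ` K)) = fst ` K"
      and sub_snd: "topspace (subtopology X (snd ` K)) = snd ` K"
      using closedin_subset[OF cl1] closedin_subset[OF cl2] by (simp_all add: Int_absorb1)
    have "\<exists>f'. continuous_map Y euclidean f' \<and> f' ` topspace Y \<subseteq> unit_cube \<and>
        (\<forall>y\<in>topspace Y. dist (f y) (f' y) \<le> \<epsilon>) \<and>
        (\<forall>z\<in>K. \<exists>v w. R v w \<and> f' (pair_value g v z) \<noteq> f' (pair_value g w z))"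
      \<comment> \<open>If no \<open>g i x\<close> meets a \<open>g j y\<close>, then \<open>x\<close> and \<open>y\<close> vary independently. Otherwise \<open>y\<close> is determined
        by \<open>x\<close> because \<open>g j\<close> is injective, and only the dimension of the set of the \<open>x\<close> counts.\<close>
    proof (cases "\<exists>i\<in>{1..N}. \<exists>j\<in>{1..N}. \<rho> (i, False) = \<rho> (j, True)")
      case False
      then have nocross: "\<rho> (i, False) \<noteq> \<rho> (j, True)" if "i \<in> {1..N}" "j \<in> {1..N}" for i j using that by blast
      have card_V: "card V = card ((\<lambda>i. \<rho> (i, False)) ` {1..N}) + card ((\<lambda>i. \<rho> (i, True)) ` {1..N})"
        unfolding V_split
      proof (rule card_Un_disjoint)
        show "(\<lambda>i. \<rho> (i, False)) ` {1..N} \<inter> (\<lambda>i. \<rho> (i, True)) ` {1..N} = {}" using nocross by blast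
      qed simp_all
      \<comment> \<open>Indexed by \<open>bool\<close>, the spaces of \<open>x\<close> and of
        \<open>y\<close> stay separate and contribute \<open>d1\<close> and \<open>d2\<close> to the
        sum. The new map handles every pair from the product of the two projections, which contains
        \<open>K\<close>.\<close>
      define S where "S s = subtopology X ((if s then snd else fst) ` K)" for s
      define G where "G v = g (fst v)" for v :: "nat \<times> bool"
      have val: "pair_value g v z = G v (if snd v then snd z else fst z)" for v z
        by (simp add: pair_value_def G_def)
      have topS: "topspace (S s) = (if s then snd else fst) ` K" for s
        unfolding S_def by (cases s) (simp_all only: if_True if_False sub_fst sub_snd)
      obtain f' where f': "continuous_map Y euclidean f'" "f' ` topspace Y \<subseteq> unit_cube"
        "\<And>y. y \<in> topspace Y \<Longrightarrow> dist (f y) (f' y) \<le> \<epsilon>"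
        "\<forall>x. (\<forall>t\<in>UNIV. x t \<in> topspace (S t)) \<longrightarrow>
          (\<exists>v\<in>V. \<exists>w\<in>V. R v w \<and> f' (G v (x (snd v))) \<noteq> f' (G w (x (snd w))))"
      proof -
        note obt = that
        show thesis
        proof (rule perturb_to_separate[where Y = Y and f = f and T = UNIV and S = S and V = V and \<tau> = snd and
              G = G and R = R and d = "\<lambda>s. if s then d2 else d1" and \<epsilon> = \<epsilon>])
          show "compact_space (S t)" for t
            unfolding S_def using comp1 comp2 by (intro compact_space_subtopology) simp
          show "metrizable_space (S t)" for t unfolding S_def using X(2) by (rule metrizable_space_subtopology)
          show "covering_dim_le (S t) (if t then d2 else d1)" for t
            unfolding S_def using d1(1) d2(1) by (simp split: if_split)
          show "continuous_map (S (snd v)) Y (G v)" if "v \<in> V" for v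
            unfolding S_def G_def using g[OF Vg[OF that]] by (rule continuous_map_from_subtopology)
          show "inj_on (G v) (topspace (S (snd v)))" if "v \<in> V" for v
            unfolding G_def using inj[OF Vg[OF that]]
            by (rule inj_on_subset) (use KX in \<open>auto simp: topS split: if_splits\<close>)
          show "G v ` topspace (S (snd v)) \<inter> G w ` topspace (S (snd w)) = {}"
            if vw: "v \<in> V" "w \<in> V" "v \<noteq> w" for v w
          proof -
            have "G v ` topspace (S (snd v)) = pair_value g v ` K" for v
              unfolding topS by (auto simp: val image_image)
            then show ?thesis using apart[of v w] VI vw by auto
          qed
          show "2 * (\<Sum>t\<in>UNIV. if t then d2 else d1) < CARD('r) * card V"
            using d1(2) d2(2) by (simp add: UNIV_bool card_V distrib_left)
        qed (fact normY T2Y fY finV Rsym Rnbr \<open>\<epsilon> > 0\<close> | (rule obt; assumption) | simp)+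
      qed
      have "\<exists>v w. R v w \<and> f' (pair_value g v z) \<noteq> f' (pair_value g w z)" if z: "z \<in> K" for z
      proof -
        have "\<forall>t\<in>UNIV. (if t then snd z else fst z) \<in> topspace (S t)" using z by (simp add: topS)
        from f'(4)[THEN spec, THEN mp, OF this] show ?thesis unfolding val by blast
      qed
      then show ?thesis using f'(1-3) by blast
    next
      case True
      then obtain i0 j0 where ij: "i0 \<in> {1..N}" "j0 \<in> {1..N}" "\<rho> (i0, False) = \<rho> (j0, True)" by blast
      obtain H where H: "continuous_map (subtopology Y (g j0 ` topspace X)) X H"
        "\<And>x. x \<in> topspace X \<Longrightarrow> H (g j0 x) = x"
        using continuous_injection_inverse[OF g[OF ij(2)] X(1) T2Y inj[OF ij(2)]] by blast
      \<comment> \<open>The partner of \<open>x\<close>: the coincidence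
        \<open>g i0 x = g j0 y\<close> solved for \<open>y\<close>.\<close>
      define \<eta> where "\<eta> x = H (g i0 x)" for x
      have K_eq: "g i0 (fst z) = g j0 (snd z)" if "z \<in> K" for z
        using coin[of "(i0, False)" "(j0, True)" z] ij that I by (simp add: pair_value_def)
      have \<eta>: "\<eta> (fst z) = snd z" if "z \<in> K" for z
        unfolding \<eta>_def K_eq[OF that] using H(2) KX that by blast
      have \<eta>K: "(x, \<eta> x) \<in> K" if "x \<in> fst ` K" for x using that \<eta> by force
      let ?S = "subtopology X (fst ` K)"
      have \<eta>_cont: "continuous_map ?S X \<eta>"
      proof -
        have "continuous_map ?S (subtopology Y (g j0 ` topspace X)) (g i0)"
          unfolding continuous_map_in_subtopology
        proof
          show "continuous_map ?S Y (g i0)" using g[OF ij(1)] by (rule continuous_map_from_subtopology)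
          show "g i0 \<in> topspace ?S \<rightarrow> g j0 ` topspace X"
            unfolding sub_fst using K_eq KX by fastforce
        qed
        then show ?thesis unfolding \<eta>_def[abs_def]
          using continuous_map_compose[of ?S _ "g i0", OF _ H(1)] by (simp add: o_def)
      qed
      define G where "G v x = pair_value g v (x, \<eta> x)" for v x
      \<comment> \<open>The classes met by \<open>x\<close> alone already outweigh
        \<open>d1\<close>; counting the remaining vertices as well can only help.\<close>
      have "card ((\<lambda>i. \<rho> (i, False)) ` {1..N}) \<le> card V"
        using finV by (rule card_mono) (simp add: V_split)
      then have d1V: "2 * d1 < CARD('r) * card V"
        using d1(2) by (meson less_le_trans mult_le_mono2)
      obtain f' where f': "continuous_map Y euclidean f'" "f' ` topspace Y \<subseteq> unit_cube"
        "\<And>y. y \<in> topspace Y \<Longrightarrow> dist (f y) (f' y) \<le> \<epsilon>"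
        "\<forall>x. (\<forall>t\<in>{()}. x t \<in> topspace ?S) \<longrightarrow>
          (\<exists>v\<in>V. \<exists>w\<in>V. R v w \<and> f' (G v (x ())) \<noteq> f' (G w (x ())))"
      proof -
        note obt = that
        show thesis
        proof (rule perturb_to_separate[where Y = Y and f = f and T = "{()}" and S = "\<lambda>_. ?S" and V = V and
              \<tau> = "\<lambda>_. ()" and G = G and R = R and d = "\<lambda>_. d1" and \<epsilon> = \<epsilon>])
          show "compact_space ?S" using comp1 by (rule compact_space_subtopology)
          show "metrizable_space ?S" using X(2) by (rule metrizable_space_subtopology)
          show "covering_dim_le ?S d1" by (rule d1(1))
          show "continuous_map ?S Y (G v)" if "v \<in> V" for v
          proof (cases "snd v")
            case True
            then show ?thesis using continuous_map_compose[OF \<eta>_cont g[OF Vg[OF that]]]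
              by (simp add: G_def[abs_def] pair_value_def o_def)
          next
            case False
            then show ?thesis using continuous_map_from_subtopology[OF g[OF Vg[OF that]]]
              by (simp add: G_def[abs_def] pair_value_def)
          qed
          show "inj_on (G v) (topspace ?S)" if v: "v \<in> V" for v
            unfolding sub_fst
          proof (rule inj_onI)
            fix x x' assume x: "x \<in> fst ` K" "x' \<in> fst ` K" and eq: "G v x = G v x'"
            have xX: "x \<in> topspace X" "x' \<in> topspace X" "\<eta> x \<in> topspace X" "\<eta> x' \<in> topspace X"
              using KX[OF \<eta>K[OF x(1)]] KX[OF \<eta>K[OF x(2)]] by auto
            show "x = x'"
            proof (cases "snd v")
              case True
              then have "\<eta> x = \<eta> x'"
                using eq inj[OF Vg[OF v]] xX by (simp add: G_def pair_value_def inj_on_eq_iff)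
              \<comment> \<open>The same coincidence read backwards: the partner determines
                \<open>x\<close>, so vertices on the side of \<open>y\<close> are injective in
                \<open>x\<close> too.\<close>
              then have "g i0 x = g i0 x'" using K_eq[OF \<eta>K[OF x(1)]] K_eq[OF \<eta>K[OF x(2)]] by simp
              then show ?thesis using inj[OF ij(1)] xX by (simp add: inj_on_eq_iff)
            next
              case False
              then show ?thesis
                using eq inj[OF Vg[OF v]] xX by (simp add: G_def pair_value_def inj_on_eq_iff)
            qed
          qed
          show "G v ` topspace ?S \<inter> G w ` topspace ?S = {}" if "v \<in> V" "w \<in> V" "v \<noteq> w" for v w
          proof -
            have "G v x \<noteq> G w x'" if "x \<in> fst ` K" "x' \<in> fst ` K" for x x'
              unfolding G_def using apart[of v w] VI \<eta>K that \<open>v \<in> V\<close> \<open>w \<in> V\<close> \<open>v \<noteq> w\<close> by simp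
            then show ?thesis unfolding sub_fst by auto
          qed
          show "2 * (\<Sum>t\<in>{()}. d1) < CARD('r) * card V" using d1V by simp
        qed (fact normY T2Y fY finV Rsym Rnbr \<open>\<epsilon> > 0\<close> | (rule obt; assumption) | simp)+
      qed
      have "\<exists>v w. R v w \<and> f' (pair_value g v z) \<noteq> f' (pair_value g w z)" if z: "z \<in> K" for z
      proof -
        have "fst z \<in> fst ` K" using z by blast
        moreover have "(fst z, \<eta> (fst z)) = z" using \<eta>[OF z] by simp
        ultimately show ?thesis using f'(4)[THEN spec, THEN mp, of "\<lambda>_. fst z"] unfolding sub_fst G_def by auto
      qed
      then show ?thesis using f'(1-3) by blast
    qed
    then obtain f' where f': "continuous_map Y euclidean f'" "f' ` topspace Y \<subseteq> unit_cube"
        "\<And>y. y \<in> topspace Y \<Longrightarrow> dist (f y) (f' y) \<le> \<epsilon>"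
        "\<And>z. z \<in> K \<Longrightarrow> \<exists>v w. R v w \<and> f' (pair_value g v z) \<noteq> f' (pair_value g w z)"
      by blast
    \<comment> \<open>Points of the function space are extensional, so values off
      \<open>topspace Y\<close> are erased.\<close>
    define h where "h = restrict f' (topspace Y)"
    have h: "h y = f' y" if "y \<in> topspace Y" for y using that by (simp add: h_def)
    have "continuous_map Y euclidean h" by (rule continuous_map_eq[OF f'(1)]) (simp add: h)
    then have hm: "h \<in> mspace (cube_maps Y)"
      using f'(2) by (auto simp: mspace_cube_maps[OF Y(1)] h_def)
    have "mdist (cube_maps Y) f h \<le> \<epsilon>"
      unfolding cube_maps_def
    proof (rule mdist_cfunspace_le)
      show "0 \<le> \<epsilon>" using \<open>\<epsilon> > 0\<close> by simp
      show "mdist (submetric euclidean_metric unit_cube) (f y) (h y) \<le> \<epsilon>" if "y \<in> topspace Y" for y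
        using f'(3)[OF that] h[OF that] by simp
    qed
    moreover have "\<exists>i\<in>{1..N}. h (g i (fst z)) \<noteq> h (g i (snd z))" if z: "z \<in> K" for z
    proof -
      obtain v w where vw: "R v w" "f' (pair_value g v z) \<noteq> f' (pair_value g w z)" using f'(4)[OF z] by blast
      obtain i s where iss: "i \<in> {1..N}" "v = \<rho> (i, s)" "w = \<rho> (i, \<not> s)" using vw(1) R_def by blast
      have gY: "g i x \<in> topspace Y" if "x \<in> topspace X" for x
        using g[OF iss(1)] that by (meson continuous_map_image_subset_topspace image_subset_iff)
      \<comment> \<open>Back from the representatives to the index \<open>i\<close> of the edge: on
        \<open>K\<close> a representative has the same value as each index of its class.\<close>
      have "f' (pair_value g (i, s) z) \<noteq> f' (pair_value g (i, \<not> s) z)"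
        using vw(2) val_\<rho>[of "(i, s)" z] val_\<rho>[of "(i, \<not> s)" z] iss z I by simp
      then have "f' (g i (fst z)) \<noteq> f' (g i (snd z))" by (cases s) (auto simp: pair_value_def)
      then show ?thesis using iss(1) h[OF gY] KX[OF z] by (intro bexI[of _ i]) simp_all
    qed
    then have "\<forall>(x, y)\<in>K. \<exists>i\<in>{1..N}. h (g i x) \<noteq> h (g i y)" by fastforce
    ultimately show ?thesis using hm unfolding K_def[symmetric] by blast
  qed
  interpret M: Metric_space "mspace ?m" "mdist ?m" by (rule Metric_space_mspace_mdist)
  have C: "C = M.mtopology" by (simp add: C_def mtopology_of_def)
  have topC: "topspace C = mspace ?m" by (simp add: C)
  have T2Y: "Hausdorff_space Y" using Y(2) by (rule metrizable_imp_Hausdorff_space)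
  obtain \<B> where \<B>: "countable \<B>" "\<And>B. B \<in> \<B> \<Longrightarrow> closedin X B"
    "\<And>U x. openin X U \<Longrightarrow> x \<in> U \<Longrightarrow> \<exists>B\<in>\<B>. x \<in> B \<and> B \<subseteq> U"
    using countable_closed_neighbourhood_base[OF X] by blast
  define \<C> where "\<C> = {(A, B, \<rho>). A \<in> \<B> \<and> B \<in> \<B> \<and> \<rho> \<in> pair_indices N \<rightarrow>\<^sub>E pair_indices N \<and>
      separated_pattern N g A B \<rho>}"
  define U where "U = (\<lambda>(A, B, \<rho>). {f \<in> mspace ?m.
      \<forall>(x, y)\<in>pattern_pairs N g A B \<rho>. \<exists>i\<in>{1..N}. f (g i x) \<noteq> f (g i y)})"
  have "finite (pair_indices N \<rightarrow>\<^sub>E pair_indices N)"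
    by (intro finite_PiE) (simp_all add: pair_indices_def)
  then have "countable (\<B> \<times> \<B> \<times> (pair_indices N \<rightarrow>\<^sub>E pair_indices N))"
    using \<B>(1) by (simp add: countable_finite)
  then have count: "countable \<C>" by (rule countable_subset[rotated]) (auto simp: \<C>_def)
  have opU: "openin C (U c)" if "c \<in> \<C>" for c
  proof -
    obtain A B \<rho> where c: "c = (A, B, \<rho>)" "A \<in> \<B>" "B \<in> \<B>" using \<open>c \<in> \<C>\<close> by (auto simp: \<C>_def)
    have "compactin (prod_topology X X) (pattern_pairs N g A B \<rho>)"
      using X(1) T2Y g \<B>(2)[OF c(2)] \<B>(2)[OF c(3)] by (rule compactin_pattern_pairs)
    with Y(1) g show ?thesis unfolding U_def c(1) C_def prod.case by (rule openin_separating_maps)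
  qed
  have denseU: "C closure_of U c = topspace C" if "c \<in> \<C>" for c
  proof -
    obtain A B \<rho> where c: "c = (A, B, \<rho>)" "A \<in> \<B>" "B \<in> \<B>" "separated_pattern N g A B \<rho>"
      using \<open>c \<in> \<C>\<close> by (auto simp: \<C>_def)
    have "\<exists>f'\<in>U c. f' \<in> M.mcball f r" if f: "f \<in> mspace ?m" "r > 0" for f r
    proof -
      obtain f' where "f' \<in> mspace ?m" "mdist ?m f f' \<le> r"
        "\<forall>(x, y)\<in>pattern_pairs N g A B \<rho>. \<exists>i\<in>{1..N}. f' (g i x) \<noteq> f' (g i y)"
        using dense[OF \<B>(2)[OF c(2)] \<B>(2)[OF c(3)] c(4) f] by blast
      then show ?thesis using f(1) by (intro bexI[of _ f']) (auto simp: U_def c(1))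
    qed
    then show ?thesis unfolding C M.metric_closure_of_alt by auto
  qed
  \<comment> \<open>The whole space is inserted because \<open>\<C>\<close> may be empty, and an
    empty intersection would be \<open>UNIV\<close>.\<close>
  have S_eq: "S = \<Inter> (insert (topspace C) (U ` \<C>))"
  proof (intro equalityI subsetI)
    fix f assume f: "f \<in> S"
    have "f \<in> U c" if "c \<in> \<C>" for c
    proof -
      obtain A B \<rho> where c: "c = (A, B, \<rho>)" "A \<in> \<B>" "B \<in> \<B>" "separated_pattern N g A B \<rho>"
        using \<open>c \<in> \<C>\<close> by (auto simp: \<C>_def)
      have "\<exists>i\<in>{1..N}. f (g i x) \<noteq> f (g i y)" if xy: "(x, y) \<in> pattern_pairs N g A B \<rho>" for x y
      proof -
        have "x \<in> topspace X" "y \<in> topspace X"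
          using xy \<B>(2)[OF c(2)] \<B>(2)[OF c(3)] closedin_subset by (auto simp: pattern_pairs_def)
        moreover have "x \<noteq> y" using c(4) N xy by (rule separated_pattern_imp_neq)
        ultimately have "tuple_map N g f x \<noteq> tuple_map N g f y"
          using f unfolding S_def inj_on_def by blast
        moreover have "tuple_map N g f x = tuple_map N g f y" if "\<forall>i\<in>{1..N}. f (g i x) = f (g i y)"
          unfolding tuple_map_def by (rule restrict_ext) (use that in blast)
        ultimately show ?thesis by blast
      qed
      then have "\<forall>(x, y)\<in>pattern_pairs N g A B \<rho>. \<exists>i\<in>{1..N}. f (g i x) \<noteq> f (g i y)" by blast
      then show ?thesis using f by (simp add: U_def c(1) S_def)
    qed
    then show "f \<in> \<Inter> (insert (topspace C) (U ` \<C>))" using f by (auto simp: S_def topC)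
  next
    fix f assume f: "f \<in> \<Inter> (insert (topspace C) (U ` \<C>))"
    have "inj_on (tuple_map N g f) (topspace X)"
    proof (rule inj_onI, rule ccontr)
      fix x y assume xy: "x \<in> topspace X" "y \<in> topspace X" and eq: "tuple_map N g f x = tuple_map N g f y"
        and "x \<noteq> y"
      obtain A B \<rho> where "A \<in> \<B>" "B \<in> \<B>" "\<rho> \<in> pair_indices N \<rightarrow>\<^sub>E pair_indices N"
        "separated_pattern N g A B \<rho>" and in_pp: "(x, y) \<in> pattern_pairs N g A B \<rho>"
        by (rule separated_pattern_exists[OF T2Y g inj \<B>(3) xy \<open>x \<noteq> y\<close>])
      then have "(A, B, \<rho>) \<in> \<C>" by (simp add: \<C>_def)
      then have "f \<in> U (A, B, \<rho>)" using f by blast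
      then obtain i where i: "i \<in> {1..N}" "f (g i x) \<noteq> f (g i y)" using in_pp by (auto simp: U_def)
      have "tuple_map N g f x i = tuple_map N g f y i" using eq by simp
      then show False using i by (simp add: tuple_map_def)
    qed
    then show "f \<in> S" using f by (simp add: S_def topC)
  qed
  have opG: "openin C T" if "T \<in> insert (topspace C) (U ` \<C>)" for T using that opU by auto
  have "gdelta_in C S"
    unfolding S_eq by (rule gdelta_in_Inter) (use count opG in \<open>auto intro: open_imp_gdelta_in\<close>)
  moreover have "C closure_of S = topspace C"
    unfolding S_eq
  proof (rule Baire_category)
    show "completely_metrizable_space C \<or> locally_compact_space C \<and> regular_space C"
      unfolding C_def using completely_metrizable_cube_maps by blast
    show "countable (insert (topspace C) (U ` \<C>))" using count by simp
    show "openin C T \<and> C closure_of T = topspace C" if "T \<in> insert (topspace C) (U ` \<C>)" for T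
      using opG[OF that] that denseU by auto
  qed
  ultimately show ?thesis by blast
qed

end
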